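(* Let $X$ be a linear order such that $X^n \cong X$ for some integer $n>1$. Then $X^2 \cong X$. (In particular, every linear order isomorphic to its cube is isomorphic to its square.)
   Context: Linear orders are multiplied by the lexicographical product: $X\times Y$ (written $XY$) is the set of pairs $(x,y)$ ordered by $(x_0,y_0)<(x_1,y_1)$ iff $x_0<x_1$, or $x_0=x_1$ and $y_0<y_1$. $X^n$ denotes the $n$-fold lexicographic power (tuples ordered lexicographically). $\cong$ means order isomorphism. *)

theory Defs
  imports Main
begin

text \<open>A linear order is a carrier \<open>A\<close> (possibly empty) with a strict order relation \<open>r\<close>
  such that \<open>strict_linear_order_on A r\<close>. Only the part of \<open>r\<close> on \<open>A\<close> matters below.\<close>

definition order_isomorphic :: "'a set \<Rightarrow> 'a rel \<Rightarrow> 'b set \<Rightarrow> 'b rel \<Rightarrow> bool" where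
  "order_isomorphic A r B s \<longleftrightarrow>
     (\<exists>f. bij_betw f A B \<and> (\<forall>x\<in>A. \<forall>y\<in>A. (x, y) \<in> r \<longleftrightarrow> (f x, f y) \<in> s))"

text \<open>The carrier of the \<open>n\<close>-fold power; its lexicographic order is \<open>lexn r n\<close>.\<close>

definition tuples :: "'a set \<Rightarrow> nat \<Rightarrow> 'a list set" where
  "tuples A n = {xs \<in> lists A. length xs = n}"

lemma Cons_in_lexn_Suc_iff:
  assumes "length xs = n" "length ys = n"
  shows "(x # xs, y # ys) \<in> lexn r (Suc n) \<longleftrightarrow> (x, y) \<in> r \<or> x = y \<and> (xs, ys) \<in> lexn r n"
proof
  assume "(x # xs, y # ys) \<in> lexn r (Suc n)"
  then show "(x, y) \<in> r \<or> x = y \<and> (xs, ys) \<in> lexn r n"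
    by auto
next
  assume "(x, y) \<in> r \<or> x = y \<and> (xs, ys) \<in> lexn r n"
  then have "((x, xs), (y, ys)) \<in> r <*lex*> lexn r n"
    by simp
  from imageI[OF this, of "map_prod (\<lambda>(x, xs). x # xs) (\<lambda>(x, xs). x # xs)"]
  show "(x # xs, y # ys) \<in> lexn r (Suc n)"
    using assms by simp
qed

lemma order_isomorphic_power_Suc:
  "order_isomorphic (A \<times> tuples A n) (r <*lex*> lexn r n) (tuples A (Suc n)) (lexn r (Suc n))"
  unfolding order_isomorphic_def
proof (intro exI conjI)
  let ?f = "\<lambda>(x, xs). x # xs"
  show "bij_betw ?f (A \<times> tuples A n) (tuples A (Suc n))"
    by (rule bij_betw_byWitness[where f' = "\<lambda>xs. (hd xs, tl xs)"])
      (auto simp: tuples_def length_Suc_conv)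
  show "\<forall>p\<in>A \<times> tuples A n. \<forall>q\<in>A \<times> tuples A n.
      (p, q) \<in> r <*lex*> lexn r n \<longleftrightarrow> (?f p, ?f q) \<in> lexn r (Suc n)"
    by (auto simp: tuples_def Cons_in_lexn_Suc_iff simp del: lexn.simps(2))
qed

lemma order_isomorphic_power_2:
  "order_isomorphic (A \<times> A) (r <*lex*> r) (tuples A 2) (lexn r 2)"
  unfolding order_isomorphic_def
proof (intro exI conjI)
  let ?f = "\<lambda>(x, y). [x, y]"
  show "bij_betw ?f (A \<times> A) (tuples A 2)"
    by (rule bij_betw_byWitness[where f' = "\<lambda>xs. (hd xs, hd (tl xs))"])
      (auto simp: tuples_def length_Suc_conv numeral_2_eq_2)
  show "\<forall>p\<in>A \<times> A. \<forall>q\<in>A \<times> A. (p, q) \<in> r <*lex*> r \<longleftrightarrow> (?f p, ?f q) \<in> lexn r 2"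
    by (auto simp: numeral_2_eq_2 Cons_in_lexn_Suc_iff simp del: lexn.simps(2))
qed

end

theory Submission
  imports Defs "HOL-Library.Nat_Bijection"
begin

text \<open>Let \<open>F : X \<cong> X\<^sup>k\<^sup>+\<^sup>1\<close> with \<open>k \<ge> 2\<close>, and let \<open>G\<close> be the first coordinate of \<open>F\<close>. If \<open>X\<close> has both
  endpoints, then \<open>X\<close> embeds in \<open>X\<^sup>2\<close> as an initial segment and \<open>X\<^sup>2\<close> embeds in \<open>X\<close> as a final one, so
  Lindenbaum's theorem applies. Otherwise assume, up to reversal, that \<open>X\<close> has no maximum. The total
  preorder \<open>\<exists>a b. G\<^sup>a x \<le> G\<^sup>b y\<close> splits \<open>X\<close> into convex classes \<open>M\<close> closed under \<open>G\<close> and its inverse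
  images, so that \<open>F\<close> restricts to \<open>M \<cong> M X\<^sup>k\<close>; it suffices to prove \<open>M \<cong> M X\<close> for each class.

  A class without minimum has countable cofinality and coinitiality. Iterating \<open>F\<close> on the last
  coordinate turns elements of \<open>X\<close> into infinite sequences; cut \<open>M\<close> and \<open>M X\<close> at constant sequences
  \<open>a\<^sub>i a\<^sub>i a\<^sub>i \<dots>\<close> where \<open>(a\<^sub>i)\<close>, indexed by the integers, is increasing and unbounded in \<open>M\<close> in both
  directions. Between \<open>xxx\<dots>\<close> and \<open>yyy\<dots>\<close> prepending \<open>x\<close> and prepending \<open>y\<^sup>k\<^sup>-\<^sup>1\<close> are embeddings to which
  Lindenbaum's theorem applies again. A class with a minimum consists of the points that some
  power of \<open>G\<close> sends to the minimum; reading off the coordinates forgotten by \<open>G\<close> identifies both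
  \<open>M\<close> and \<open>M X\<close> with the finitely supported sequences in \<open>X\<^sup>k\<close>.\<close>

section \<open>Isomorphism of linear orders\<close>

lemma order_isomorphicI:
  assumes "bij_betw f A B" "\<And>x y. x \<in> A \<Longrightarrow> y \<in> A \<Longrightarrow> (x, y) \<in> r \<longleftrightarrow> (f x, f y) \<in> s"
  shows "order_isomorphic A r B s"
  using assms unfolding order_isomorphic_def by blast

lemma order_isomorphic_sym:
  assumes "order_isomorphic A r B s"
  shows "order_isomorphic B s A r"
proof -
  obtain f where f: "bij_betw f A B" "\<forall>x\<in>A. \<forall>y\<in>A. (x, y) \<in> r \<longleftrightarrow> (f x, f y) \<in> s"
    using assms unfolding order_isomorphic_def by blast
  show ?thesis
  proof (rule order_isomorphicI)
    show "bij_betw (inv_into A f) B A" by (rule bij_betw_inv_into[OF f(1)])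
    fix x y assume "x \<in> B" "y \<in> B"
    then show "(x, y) \<in> s \<longleftrightarrow> (inv_into A f x, inv_into A f y) \<in> r"
      using f by (metis bij_betw_imp_surj_on f_inv_into_f inv_into_into)
  qed
qed

lemma order_isomorphic_trans:
  assumes "order_isomorphic A r B s" "order_isomorphic B s C t"
  shows "order_isomorphic A r C t"
proof -
  obtain f g where f: "bij_betw f A B" "\<forall>x\<in>A. \<forall>y\<in>A. (x, y) \<in> r \<longleftrightarrow> (f x, f y) \<in> s"
    and g: "bij_betw g B C" "\<forall>x\<in>B. \<forall>y\<in>B. (x, y) \<in> s \<longleftrightarrow> (g x, g y) \<in> t"
    using assms unfolding order_isomorphic_def by blast
  show ?thesis
  proof (rule order_isomorphicI[of "g \<circ> f"])
    show "bij_betw (g \<circ> f) A C" by (rule bij_betw_trans[OF f(1) g(1)])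
    fix x y assume "x \<in> A" "y \<in> A"
    then show "(x, y) \<in> r \<longleftrightarrow> ((g \<circ> f) x, (g \<circ> f) y) \<in> t"
      using f(2) g(2) bij_betwE[OF f(1)] by simp
  qed
qed

lemma order_isomorphic_converse:
  "order_isomorphic A r B s \<Longrightarrow> order_isomorphic A (r\<inverse>) B (s\<inverse>)"
  unfolding order_isomorphic_def by blast

lemma order_isomorphic_cong:
  assumes "order_isomorphic A r B s"
    and "\<And>x y. x \<in> A \<Longrightarrow> y \<in> A \<Longrightarrow> (x, y) \<in> r \<longleftrightarrow> (x, y) \<in> r'"
    and "\<And>x y. x \<in> B \<Longrightarrow> y \<in> B \<Longrightarrow> (x, y) \<in> s \<longleftrightarrow> (x, y) \<in> s'"
  shows "order_isomorphic A r' B s'"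
proof -
  obtain f where f: "bij_betw f A B" "\<forall>x\<in>A. \<forall>y\<in>A. (x, y) \<in> r \<longleftrightarrow> (f x, f y) \<in> s"
    using assms(1) unfolding order_isomorphic_def by blast
  show ?thesis
    by (rule order_isomorphicI[OF f(1)]) (use assms(2,3) f(2) bij_betwE[OF f(1)] in simp)
qed

text \<open>Isomorphisms of the fibres, chosen simultaneously, combine into one label-preserving
  map. Instead of an order on the labels, \<open>cross\<close> asks that elements with different
  labels compare alike on both sides. The labels used later are classes of a preorder and upward
  closed sets of integers.\<close>

lemma order_isomorphic_glue:
  assumes img: "c ` A = c' ` B"
    and fib: "\<And>i. i \<in> c ` A \<Longrightarrow> order_isomorphic {x\<in>A. c x = i} r {y\<in>B. c' y = i} s"
    and cross: "\<And>x x' y y'. x \<in> A \<Longrightarrow> x' \<in> A \<Longrightarrow> y \<in> B \<Longrightarrow> y' \<in> B \<Longrightarrow>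
      c x = c' y \<Longrightarrow> c x' = c' y' \<Longrightarrow> c x \<noteq> c x' \<Longrightarrow> (x, x') \<in> r \<longleftrightarrow> (y, y') \<in> s"
  shows "order_isomorphic A r B s"
proof -
  have "\<forall>i\<in>c ` A. \<exists>f. bij_betw f {x\<in>A. c x = i} {y\<in>B. c' y = i} \<and>
      (\<forall>x\<in>{x\<in>A. c x = i}. \<forall>y\<in>{x\<in>A. c x = i}. (x, y) \<in> r \<longleftrightarrow> (f x, f y) \<in> s)"
    using fib unfolding order_isomorphic_def by blast
  then obtain h where h: "\<And>i. i \<in> c ` A \<Longrightarrow> bij_betw (h i) {x\<in>A. c x = i} {y\<in>B. c' y = i}"
    and ord: "\<And>i x y. i \<in> c ` A \<Longrightarrow> x \<in> A \<Longrightarrow> y \<in> A \<Longrightarrow> c x = i \<Longrightarrow> c y = i \<Longrightarrow>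
      (x, y) \<in> r \<longleftrightarrow> (h i x, h i y) \<in> s"
    unfolding bchoice_iff by blast
  define f where "f x = h (c x) x" for x
  have f: "f x \<in> B \<and> c' (f x) = c x" if "x \<in> A" for x
    using bij_betwE[OF h[of "c x"]] that unfolding f_def by blast
  have "bij_betw f A B"
    unfolding bij_betw_def
  proof
    show "inj_on f A"
    proof (rule inj_onI)
      fix x y assume xy: "x \<in> A" "y \<in> A" "f x = f y"
      then have c: "c x = c y" using f by metis
      have "inj_on (h (c x)) {z\<in>A. c z = c x}"
        using h[of "c x"] xy(1) by (auto simp: bij_betw_def)
      then show "x = y" using xy c unfolding f_def inj_on_def by simp
    qed
    show "f ` A = B"
    proof
      show "f ` A \<subseteq> B" using f by blast
      show "B \<subseteq> f ` A"
      proof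
        fix y assume y: "y \<in> B"
        then have i: "c' y \<in> c ` A" using img by blast
        then have "y \<in> h (c' y) ` {x\<in>A. c x = c' y}"
          using bij_betw_imp_surj_on[OF h[OF i]] y by blast
        then show "y \<in> f ` A" unfolding f_def by force
      qed
    qed
  qed
  then show ?thesis
  proof (rule order_isomorphicI)
    fix x y assume xy: "x \<in> A" "y \<in> A"
    show "(x, y) \<in> r \<longleftrightarrow> (f x, f y) \<in> s"
    proof (cases "c x = c y")
      case True
      have "(x, y) \<in> r \<longleftrightarrow> (h (c x) x, h (c x) y) \<in> s"
        by (rule ord) (use xy True in simp_all)
      then show ?thesis using True unfolding f_def by simp
    next
      case False
      show ?thesis by (rule cross) (use f xy False in simp_all)
    qed
  qed
qed

text \<open>Lindenbaum's Schroeder--Bernstein theorem. The Banach decomposition respects the order since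
  the least fixed point involved is an initial segment.\<close>

lemma Lindenbaum:
  assumes A: "irrefl r" "trans r" "total_on A r" and B: "irrefl s" "trans s" "total_on B s"
    and f: "f ` A \<subseteq> B" "\<And>x y. x \<in> A \<Longrightarrow> y \<in> A \<Longrightarrow> (x, y) \<in> r \<longleftrightarrow> (f x, f y) \<in> s"
    and f_init: "\<And>x y. x \<in> A \<Longrightarrow> y \<in> B \<Longrightarrow> (y, f x) \<in> s \<Longrightarrow> y \<in> f ` A"
    and g: "g ` B \<subseteq> A" "\<And>x y. x \<in> B \<Longrightarrow> y \<in> B \<Longrightarrow> (x, y) \<in> s \<longleftrightarrow> (g x, g y) \<in> r"
    and g_final: "\<And>x y. x \<in> B \<Longrightarrow> y \<in> A \<Longrightarrow> (g x, y) \<in> r \<Longrightarrow> y \<in> g ` B"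
  shows "order_isomorphic A r B s"
proof -
  \<comment> \<open>A fixed point of \<open>\<Phi>\<close> splits \<open>A\<close> into
    \<open>S\<close>, to be mapped by \<open>f\<close>, and a rest that is the
    \<open>g\<close>-image of everything in \<open>B\<close> missed by \<open>f\<close> on
    \<open>S\<close>.\<close>
  define \<Phi> where "\<Phi> S = A - g ` (B - f ` S)" for S
  define S where "S = lfp \<Phi>"
  have mono: "mono \<Phi>" unfolding \<Phi>_def mono_def by blast
  have S: "S = A - g ` (B - f ` S)"
    using lfp_unfold[OF mono] unfolding S_def \<Phi>_def .
  define Init where "Init T \<longleftrightarrow> T \<subseteq> A \<and> (\<forall>x\<in>T. \<forall>y\<in>A. (y, x) \<in> r \<longrightarrow> y \<in> T)" for T
  have f_Init: "y \<in> f ` T" if "Init T" "x \<in> T" "y \<in> B" "(y, f x) \<in> s" for T x y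
  proof -
    have "x \<in> A" using that unfolding Init_def by blast
    then obtain x' where x': "x' \<in> A" "y = f x'" using f_init \<open>y \<in> B\<close> \<open>(y, f x) \<in> s\<close> by blast
    then have "(x', x) \<in> r" using f(2) \<open>x \<in> A\<close> that by blast
    then show ?thesis using that x' unfolding Init_def by blast
  qed
  \<comment> \<open>Being initial survives unions. It survives \<open>\<Phi>\<close> because
    \<open>f\<close> sends an initial segment of \<open>A\<close> to one of \<open>B\<close>, whose
    complement \<open>g\<close> sends to a final segment of \<open>A\<close>.\<close>
  have "Init S"
    unfolding S_def
  proof (rule lfp_ordinal_induct_set[OF mono])
    fix T assume T: "Init T"
    show "Init (\<Phi> T)"
      unfolding Init_def
    proof (intro conjI ballI impI)
      show "\<Phi> T \<subseteq> A" unfolding \<Phi>_def by blast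
      fix x y assume x: "x \<in> \<Phi> T" and y: "y \<in> A" "(y, x) \<in> r"
      show "y \<in> \<Phi> T"
      proof (rule ccontr)
        assume "y \<notin> \<Phi> T"
        then obtain b where b: "b \<in> B" "b \<notin> f ` T" "y = g b" using y unfolding \<Phi>_def by blast
        have xA: "x \<in> A" using x unfolding \<Phi>_def by blast
        then obtain b' where b': "b' \<in> B" "x = g b'" using g_final[OF b(1), of x] y b by blast
        then have "b' \<in> f ` T" using x unfolding \<Phi>_def by blast
        then obtain t where t: "t \<in> T" "b' = f t" by blast
        have "(b, f t) \<in> s" using g(2)[OF b(1) b'(1)] y b b' t by simp
        then show False using f_Init[OF T t(1) b(1)] b by blast
      qed
    qed
  next
    fix M assume "\<forall>T\<in>M. Init T"
    then show "Init (\<Union>M)" unfolding Init_def by blast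
  qed
  have SA: "S \<subseteq> A" using \<open>Init S\<close> unfolding Init_def by blast
  have inj_f: "inj_on f A"
  proof (rule inj_onI, rule ccontr)
    fix x y assume "x \<in> A" "y \<in> A" "f x = f y" "x \<noteq> y"
    then show False using A B f(2) unfolding total_on_def irrefl_def by metis
  qed
  have inj_g: "inj_on g B"
  proof (rule inj_onI, rule ccontr)
    fix x y assume "x \<in> B" "y \<in> B" "g x = g y" "x \<noteq> y"
    then show False using A B g(2) unfolding total_on_def irrefl_def by metis
  qed
  define h where "h x = (if x \<in> S then f x else inv_into B g x)" for x
  have out: "h x \<in> B - f ` S \<and> g (h x) = x" if "x \<in> A - S" for x
  proof -
    have "x \<in> g ` (B - f ` S)" using that S by blast
    then obtain b where "b \<in> B - f ` S" "x = g b" by blast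
    moreover have "inv_into B g (g b) = b" using inj_g \<open>b \<in> _\<close> by simp
    ultimately show ?thesis using that unfolding h_def by simp
  qed
  have inn: "h x = f x" if "x \<in> S" for x using that unfolding h_def by simp
  have "bij_betw h A B"
    unfolding bij_betw_def
  proof
    show "inj_on h A"
    proof (rule inj_onI)
      fix x y assume xy: "x \<in> A" "y \<in> A" "h x = h y"
      show "x = y"
      proof (cases "x \<in> S"; cases "y \<in> S")
        assume "x \<in> S" "y \<in> S"
        then show ?thesis using inn xy inj_onD[OF inj_f] by metis
      next
        assume "x \<in> S" "y \<notin> S"
        then have "h x \<in> f ` S" "h y \<notin> f ` S" using inn out[of y] xy(2) by auto
        then show ?thesis using xy(3) by simp
      next
        assume "x \<notin> S" "y \<in> S"
        then have "h y \<in> f ` S" "h x \<notin> f ` S" using inn out[of x] xy(1) by auto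
        then show ?thesis using xy(3) by simp
      next
        assume "x \<notin> S" "y \<notin> S"
        then have "g (h x) = x" "g (h y) = y" using out xy(1,2) by simp_all
        then show ?thesis using xy(3) by metis
      qed
    qed
    show "h ` A = B"
    proof
      show "h ` A \<subseteq> B" using out inn f(1) SA by (metis DiffD1 DiffI image_subset_iff)
      show "B \<subseteq> h ` A"
      proof
        fix b assume b: "b \<in> B"
        show "b \<in> h ` A"
        proof (cases "b \<in> f ` S")
          case True
          then show ?thesis using inn SA by force
        next
          case False
          then have gb: "g b \<in> A" "g b \<notin> S" using b g(1) S by blast+
          then have "h (g b) = b" using out[of "g b"] inj_onD[OF inj_g, of "h (g b)" b] b by blast
          then show ?thesis using gb by force
        qed
      qed
    qed
  qed
  then show ?thesis
  proof (rule order_isomorphicI)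
    \<comment> \<open>\<open>S\<close> lies entirely below the rest of \<open>A\<close>, and so do
      the images; this settles the mixed pairs.\<close>
    have less: "(x, y) \<in> r \<and> (h x, h y) \<in> s" if x: "x \<in> S" and y: "y \<in> A - S" for x y
    proof
      have "(y, x) \<notin> r" "x \<noteq> y" using \<open>Init S\<close> x y unfolding Init_def by blast+
      then show "(x, y) \<in> r" using A(3) x y SA unfolding total_on_def by blast
      have "h y \<in> B" "h y \<notin> f ` S" using out[OF y] by blast+
      then have "(h y, f x) \<notin> s" "h y \<noteq> f x" using f_Init[OF \<open>Init S\<close> x] x by blast+
      moreover have "f x \<in> B" using f(1) x SA by blast
      ultimately show "(h x, h y) \<in> s"
        using B(3) \<open>h y \<in> B\<close> inn[OF x] unfolding total_on_def by metis
    qed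
    fix x y assume xy: "x \<in> A" "y \<in> A"
    consider "x \<in> S" "y \<in> S" | "x \<in> S" "y \<notin> S" | "x \<notin> S" "y \<in> S" | "x \<notin> S" "y \<notin> S" by blast
    then show "(x, y) \<in> r \<longleftrightarrow> (h x, h y) \<in> s"
    proof cases
      case 1
      then show ?thesis using f(2) xy inn by simp
    next
      case 2
      then show ?thesis using less xy by blast
    next
      case 3
      then have "(y, x) \<in> r \<and> (h y, h x) \<in> s" using less xy by blast
      then show ?thesis using A B unfolding irrefl_def by (meson transD)
    next
      case 4
      then have "h x \<in> B" "h y \<in> B" "g (h x) = x" "g (h y) = y" using out xy by simp_all
      then show ?thesis using g(2)[of "h x" "h y"] by simp
    qed
  qed
qed

section \<open>Sequences in linear orders\<close>

text \<open>If \<open>w\<close> enumerates a cofinal family, the sequence is cofinal. The prescribed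
  start lets an ascending and a descending sequence be joined into one indexed by the
  integers.\<close>

lemma increasing_sequence_above:
  assumes "trans r" "total_on M r" "x0 \<in> M" and w: "\<And>n. w n \<in> M"
    and no_max: "\<And>x. x \<in> M \<Longrightarrow> \<exists>y\<in>M. (x, y) \<in> r"
  shows "\<exists>u :: nat \<Rightarrow> 'a. u 0 = x0 \<and> (\<forall>n. u n \<in> M \<and> (u n, u (Suc n)) \<in> r \<and> (w n, u (Suc n)) \<in> r)"
proof -
  have "\<exists>u. \<forall>n. (u n \<in> M \<and> (n = 0 \<longrightarrow> u n = x0)) \<and> ((u n, u (Suc n)) \<in> r \<and> (w n, u (Suc n)) \<in> r)"
  proof (rule dependent_nat_choice)
    show "\<exists>x. x \<in> M \<and> (0 = 0 \<longrightarrow> x = x0)" using assms(3) by blast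
    fix x and n :: nat assume x: "x \<in> M \<and> (n = 0 \<longrightarrow> x = x0)"
    obtain y where y: "y \<in> M" "(x, y) \<in> r" using no_max x by blast
    obtain v where v: "v \<in> M" "(w n, v) \<in> r" using no_max w by blast
    have "\<exists>z\<in>M. (x, z) \<in> r \<and> (w n, z) \<in> r"
    proof (cases "y = v \<or> (y, v) \<in> r")
      case True
      then show ?thesis using y v transD[OF assms(1)] by blast
    next
      case False
      then have "(v, y) \<in> r" using assms(2) y v unfolding total_on_def by blast
      then show ?thesis using y v transD[OF assms(1)] by blast
    qed
    then show "\<exists>z. (z \<in> M \<and> (Suc n = 0 \<longrightarrow> z = x0)) \<and> ((x, z) \<in> r \<and> (w n, z) \<in> r)" by blast
  qed
  then show ?thesis by blast
qed

text \<open>\<open>P i\<close> will say that a fixed element lies below the \<open>i\<close>-th cut,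
  so \<open>n\<close> locates it between two consecutive cuts. Without a crossing, \<open>P\<close>
  would be invariant under translation, hence true everywhere once true at \<open>j\<close>.\<close>

lemma int_crossing:
  fixes P :: "int \<Rightarrow> bool"
  assumes "\<not> P i" "P j" "\<And>i. P i \<Longrightarrow> P (i + 1)"
  shows "\<exists>n. {i. P i} = {n<..}"
proof -
  have "\<exists>n. \<not> P n \<and> P (n + 1)"
  proof (rule ccontr)
    assume "\<nexists>n. \<not> P n \<and> P (n + 1)"
    then have eq: "P (n + 1) \<longleftrightarrow> P n" for n using assms(3) by blast
    have "P n" for n
    proof (induction n rule: int_induct[where k = j])
      case (step2 i)
      then show ?case using eq[of "i - 1"] by simp
    qed (use assms(2) eq in auto)
    then show False using assms(1) by blast
  qed
  then obtain n where n: "\<not> P n" "P (n + 1)" by blast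
  have "P i" if "n + 1 \<le> i" for i
    using that by (induction i rule: int_ge_induct) (use n assms(3) in auto)
  moreover have "\<not> P i" if "i \<le> n" for i
    using that
  proof (induction i rule: int_le_induct)
    case (step i)
    then show ?case using assms(3)[of "i - 1"] by auto
  qed (use n in auto)
  ultimately have "P i \<longleftrightarrow> n < i" for i by (metis linorder_not_le zless_add1_eq add1_zle_eq)
  then have "{i. P i} = {n<..}" by auto
  then show ?thesis by blast
qed

section \<open>Lexicographic powers\<close>

lemma append_in_lexn_iff:
  assumes "length us = a" "length us' = a" "length vs = b" "length vs' = b"
  shows "(us @ vs, us' @ vs') \<in> lexn r (a + b) \<longleftrightarrow>
    (us, us') \<in> lexn r a \<or> us = us' \<and> (vs, vs') \<in> lexn r b"
  using assms
proof (induction us arbitrary: us' a)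
  case Nil
  then show ?case by simp
next
  case (Cons u us)
  then obtain u' us1 a1 where eq: "us' = u' # us1" "a = Suc a1" "length us1 = a1" "length us = a1"
    by (cases us') auto
  then show ?case
    using Cons.IH[of a1 us1] Cons.prems by (auto simp: Cons_in_lexn_Suc_iff simp del: lexn.simps(2))
qed

lemma singleton_in_lexn_iff: "([x], [y]) \<in> lexn r (Suc 0) \<longleftrightarrow> (x, y) \<in> r"
  by (simp add: Cons_in_lexn_Suc_iff del: lexn.simps(2))

lemma irrefl_lexn: "irrefl r \<Longrightarrow> irrefl (lexn r n)"
  unfolding irrefl_def by (auto simp: lexn_conv)

lemma lexn_converse:
  assumes "length xs = n" "length ys = n"
  shows "(xs, ys) \<in> lexn (r\<inverse>) n \<longleftrightarrow> (ys, xs) \<in> lexn r n"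
  using assms
proof (induction n arbitrary: xs ys)
  case (Suc n)
  then show ?case
    by (cases xs; cases ys) (auto simp: Cons_in_lexn_Suc_iff simp del: lexn.simps(2))
qed simp

lemma total_on_tuples:
  assumes "total_on X r"
  shows "total_on (tuples X n) (lexn r n)"
proof (induction n)
  case 0
  then show ?case by (auto simp: tuples_def total_on_def)
next
  case (Suc n)
  show ?case
    unfolding total_on_def
  proof (intro ballI impI)
    fix xs ys assume xs: "xs \<in> tuples X (Suc n)" "ys \<in> tuples X (Suc n)" "xs \<noteq> ys"
    then obtain x xs' y ys' where eq: "xs = x # xs'" "ys = y # ys'"
      by (cases xs; cases ys) (auto simp: tuples_def)
    then have "x \<in> X" "y \<in> X" "xs' \<in> tuples X n" "ys' \<in> tuples X n"
      using xs by (auto simp: tuples_def)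
    then show "(xs, ys) \<in> lexn r (Suc n) \<or> (ys, xs) \<in> lexn r (Suc n)"
      using assms Suc.IH xs(3) eq unfolding total_on_def
      by (auto simp: Cons_in_lexn_Suc_iff tuples_def simp del: lexn.simps(2))
  qed
qed

section \<open>Eventually constant digit sequences\<close>

definition digit_seqs :: "'t set \<Rightarrow> 't \<Rightarrow> (nat \<Rightarrow> 't) set" where
  "digit_seqs T t0 = {s. range s \<subseteq> T \<and> (\<exists>n. \<forall>i\<ge>n. s i = t0)}"

text \<open>Digit \<open>i\<close> will record what step \<open>i + 1\<close> of a
  coordinate-forgetting map discards. What survives longer decides first, so significance grows with
  the index.\<close>

definition digit_less :: "'t rel \<Rightarrow> (nat \<Rightarrow> 't) rel" where
  "digit_less t = {(s, s'). \<exists>i. (s i, s' i) \<in> t \<and> (\<forall>j>i. s j = s' j)}"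

lemma digit_less_shift:
  "(s, s') \<in> digit_less t \<longleftrightarrow> (\<lambda>i. s (Suc i), \<lambda>i. s' (Suc i)) \<in> digit_less t \<or>
     (\<lambda>i. s (Suc i)) = (\<lambda>i. s' (Suc i)) \<and> (s 0, s' 0) \<in> t"
proof
  assume "(s, s') \<in> digit_less t"
  then obtain i where i: "(s i, s' i) \<in> t" "\<forall>j>i. s j = s' j" unfolding digit_less_def by blast
  show "(\<lambda>i. s (Suc i), \<lambda>i. s' (Suc i)) \<in> digit_less t \<or>
     (\<lambda>i. s (Suc i)) = (\<lambda>i. s' (Suc i)) \<and> (s 0, s' 0) \<in> t"
  proof (cases i)
    case 0
    then show ?thesis using i by auto
  next
    case (Suc i')
    then have "(s (Suc i'), s' (Suc i')) \<in> t \<and> (\<forall>j>i'. s (Suc j) = s' (Suc j))" using i by auto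
    then show ?thesis unfolding digit_less_def by blast
  qed
next
  assume "(\<lambda>i. s (Suc i), \<lambda>i. s' (Suc i)) \<in> digit_less t \<or>
     (\<lambda>i. s (Suc i)) = (\<lambda>i. s' (Suc i)) \<and> (s 0, s' 0) \<in> t"
  then show "(s, s') \<in> digit_less t"
  proof
    assume "(\<lambda>i. s (Suc i), \<lambda>i. s' (Suc i)) \<in> digit_less t"
    then obtain i where "(s (Suc i), s' (Suc i)) \<in> t" "\<forall>j>i. s (Suc j) = s' (Suc j)"
      unfolding digit_less_def by blast
    then have "\<forall>j>Suc i. s j = s' j" by (metis Suc_less_eq2)
    then show ?thesis using \<open>(s (Suc i), _) \<in> t\<close> unfolding digit_less_def by blast
  next
    assume *: "(\<lambda>i. s (Suc i)) = (\<lambda>i. s' (Suc i)) \<and> (s 0, s' 0) \<in> t"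
    then have "\<forall>j>0. s j = s' j" by (metis gr0_conv_Suc)
    then show ?thesis using * unfolding digit_less_def by blast
  qed
qed

text \<open>The code of \<open>y\<close> is \<open>e y, e (G y), e (G (G y)), ...\<close>. On codes
  \<open>G\<close> acts as the shift, and since every \<open>y\<close> reaches the fixed point
  \<open>z\<close>, codes are eventually \<open>e z\<close>. Hypothesis \<open>ord\<close> mirrors
  the shift recursion of \<open>digit_less\<close>.\<close>

lemma order_isomorphic_digit_seqs:
  assumes irr: "irrefl r" "irrefl t"
    and bij: "bij_betw (\<lambda>y. (G y, e y)) A (A \<times> T)"
    and ord: "\<And>y y'. y \<in> A \<Longrightarrow> y' \<in> A \<Longrightarrow>
      (y, y') \<in> r \<longleftrightarrow> (G y, G y') \<in> r \<or> G y = G y' \<and> (e y, e y') \<in> t"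
    and z: "z \<in> A" "G z = z"
    and ev: "\<And>y. y \<in> A \<Longrightarrow> \<exists>n. (G ^^ n) y = z"
  shows "order_isomorphic A r (digit_seqs T (e z)) (digit_less t)"
proof -
  define code where "code y i = e ((G ^^ i) y)" for y i
  have GA: "G y \<in> A" and eT: "e y \<in> T" if "y \<in> A" for y
    using bij_betwE[OF bij] that by auto
  have GnA: "(G ^^ n) y \<in> A" if "y \<in> A" for n y
    using that by (induction n) (auto intro: GA)
  have Gz: "(G ^^ n) z = z" for n using z(2) by (induction n) auto
  have code_Suc: "(\<lambda>i. code y (Suc i)) = code (G y)" for y
    by (rule ext) (simp add: code_def funpow_swap1)
  have code_0: "code y 0 = e y" for y by (simp add: code_def)
  \<comment> \<open>Induction on a number of steps after which the two orbits coincide; each step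
    strips the least significant digit from both codes.\<close>
  have key: "((y, y') \<in> r \<longleftrightarrow> (code y, code y') \<in> digit_less t) \<and> (code y = code y' \<longrightarrow> y = y')"
    if "(G ^^ n) y = (G ^^ n) y'" "y \<in> A" "y' \<in> A" for n y y'
    using that
  proof (induction n arbitrary: y y')
    case 0
    then show ?case using irr by (auto simp: irrefl_def digit_less_def)
  next
    case (Suc n)
    have IH: "((G y, G y') \<in> r \<longleftrightarrow> (code (G y), code (G y')) \<in> digit_less t) \<and>
        (code (G y) = code (G y') \<longrightarrow> G y = G y')"
      using Suc by (auto simp: funpow_swap1 intro!: Suc.IH GA)
    have "(y, y') \<in> r \<longleftrightarrow> (code y, code y') \<in> digit_less t"
      using ord[OF Suc.prems(2,3)] IH
      unfolding digit_less_shift[of "code y"] code_Suc code_0 by metis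
    moreover have "y = y'" if c: "code y = code y'"
    proof -
      have "code (G y) = code (G y')" using c by (metis code_Suc)
      moreover have "e y = e y'" using c code_0 by metis
      ultimately show ?thesis
        using IH bij_betw_imp_inj_on[OF bij] Suc.prems(2,3) unfolding inj_on_def by blast
    qed
    ultimately show ?case by blast
  qed
  \<comment> \<open>As \<open>z\<close> is fixed, waiting for the sum of the two arrival times takes
    both points to \<open>z\<close>.\<close>
  have common: "\<exists>n. (G ^^ n) y = (G ^^ n) y'" if yy: "y \<in> A" "y' \<in> A" for y y'
  proof -
    obtain n m where n: "(G ^^ n) y = z" and m: "(G ^^ m) y' = z"
      using ev[OF yy(1)] ev[OF yy(2)] by blast
    have "(G ^^ (m + n)) y = z" using n Gz by (simp add: funpow_add)
    moreover have "(G ^^ (n + m)) y' = z" using m Gz by (simp add: funpow_add)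
    ultimately show ?thesis by (metis add.commute)
  qed
  have key: "((y, y') \<in> r \<longleftrightarrow> (code y, code y') \<in> digit_less t) \<and> (code y = code y' \<longrightarrow> y = y')"
    if "y \<in> A" "y' \<in> A" for y y'
    using common[OF that] key that by blast
  \<comment> \<open>Induction on the length of the part before the constant tail: the shifted
    sequence codes some \<open>y1\<close>, and surjectivity of \<open>(G, e)\<close> supplies a
    preimage carrying digit 0.\<close>
  have surj: "s \<in> code ` A" if "range s \<subseteq> T" "\<forall>i\<ge>n. s i = e z" for n s
    using that
  proof (induction n arbitrary: s)
    case 0
    then have "s = code z" by (auto simp: code_def Gz)
    then show ?case using z by blast
  next
    case (Suc n)
    have "(\<lambda>i. s (Suc i)) \<in> code ` A"
      using Suc.prems by (intro Suc.IH) auto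
    then obtain y1 where y1: "y1 \<in> A" "code y1 = (\<lambda>i. s (Suc i))" by (metis imageE)
    have "s 0 \<in> T" using Suc.prems by blast
    then have "(y1, s 0) \<in> (\<lambda>y. (G y, e y)) ` A" using bij_betw_imp_surj_on[OF bij] y1(1) by simp
    then obtain y where y: "y \<in> A" "G y = y1" "e y = s 0" by auto
    have "code y i = s i" for i
    proof (cases i)
      case 0
      then show ?thesis using y code_0 by simp
    next
      case (Suc j)
      then show ?thesis using fun_cong[OF code_Suc[of y], of j] y y1 by simp
    qed
    then have "s = code y" by (simp add: fun_eq_iff)
    then show ?case using y(1) by blast
  qed
  show ?thesis
  proof (rule order_isomorphicI[of code])
    show "bij_betw code A (digit_seqs T (e z))"
      unfolding bij_betw_def
    proof
      show "inj_on code A" using key by (auto simp: inj_on_def)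
      show "code ` A = digit_seqs T (e z)"
      proof
        show "digit_seqs T (e z) \<subseteq> code ` A" using surj unfolding digit_seqs_def by blast
        have "code y \<in> digit_seqs T (e z)" if y: "y \<in> A" for y
        proof -
          obtain n where n: "(G ^^ n) y = z" using ev[OF y] by blast
          have "code y i = e z" if "n \<le> i" for i
          proof -
            have "(G ^^ i) y = (G ^^ (i - n)) ((G ^^ n) y)"
              using that by (metis funpow_add comp_apply le_add_diff_inverse2)
            then show ?thesis using n Gz by (simp add: code_def)
          qed
          moreover have "range (code y) \<subseteq> T" using eT GnA y by (auto simp: code_def)
          ultimately show ?thesis unfolding digit_seqs_def by blast
        qed
        then show "code ` A \<subseteq> digit_seqs T (e z)" by blast
      qed
    qed
  qed (use key in blast)
qed

section \<open>Linear orders isomorphic to a power\<close>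

text \<open>The word \<open>F x\<close> is split in two ways: as \<open>G x # E x\<close>, and into
  its first \<open>k\<close> letters and its last one. The bound on \<open>k\<close> makes the
  prefixes of \<open>k - 1\<close> equal letters used below nonempty.\<close>

locale power_fixed =
  fixes X :: "'a set" and r :: "'a rel" and k :: nat and F :: "'a \<Rightarrow> 'a list"
  assumes irr: "irrefl r" and trans: "trans r" and total: "total_on X r"
    and k: "2 \<le> k"
    and bij: "bij_betw F X (tuples X (Suc k))"
    and F_less: "\<And>x y. x \<in> X \<Longrightarrow> y \<in> X \<Longrightarrow> (x, y) \<in> r \<longleftrightarrow> (F x, F y) \<in> lexn r (Suc k)"
begin

definition G :: "'a \<Rightarrow> 'a" where "G x = hd (F x)"

definition E :: "'a \<Rightarrow> 'a list" where "E x = tl (F x)"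

definition mk :: "'a list \<Rightarrow> 'a" where "mk = inv_into X F"

lemma less_irrefl: "(x, x) \<notin> r"
  using irr by (simp add: irrefl_def)

lemma less_trans: "(x, y) \<in> r \<Longrightarrow> (y, z) \<in> r \<Longrightarrow> (x, z) \<in> r"
  using trans by (rule transD)

lemma less_asym: "(x, y) \<in> r \<Longrightarrow> (y, x) \<notin> r"
  using less_irrefl less_trans by blast

lemma less_linear: "x \<in> X \<Longrightarrow> y \<in> X \<Longrightarrow> (x, y) \<in> r \<or> x = y \<or> (y, x) \<in> r"
  using total unfolding total_on_def by blast

lemma F_tuple: "x \<in> X \<Longrightarrow> F x \<in> tuples X (Suc k)"
  using bij_betwE[OF bij] by blast

lemma F_eq: "x \<in> X \<Longrightarrow> F x = G x # E x"
  using F_tuple[of x] by (cases "F x") (auto simp: tuples_def G_def E_def)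

lemma G_in: "x \<in> X \<Longrightarrow> G x \<in> X" and E_in: "x \<in> X \<Longrightarrow> E x \<in> tuples X k"
  using F_tuple[of x] F_eq[of x] by (auto simp: tuples_def)

lemma mk_in: "us \<in> tuples X (Suc k) \<Longrightarrow> mk us \<in> X"
  and F_mk: "us \<in> tuples X (Suc k) \<Longrightarrow> F (mk us) = us"
  using bij unfolding mk_def bij_betw_def by (metis inv_into_into, metis f_inv_into_f)

lemma mk_F: "x \<in> X \<Longrightarrow> mk (F x) = x"
  using bij unfolding mk_def bij_betw_def by simp

lemma G_mk: "a # es \<in> tuples X (Suc k) \<Longrightarrow> G (mk (a # es)) = a"
  and E_mk: "a # es \<in> tuples X (Suc k) \<Longrightarrow> E (mk (a # es)) = es"
  by (simp_all add: G_def E_def F_mk)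

lemma length_E: "x \<in> X \<Longrightarrow> length (E x) = k"
  using E_in by (simp add: tuples_def)

lemma less_iff:
  assumes "x \<in> X" "y \<in> X"
  shows "(x, y) \<in> r \<longleftrightarrow> (G x, G y) \<in> r \<or> G x = G y \<and> (E x, E y) \<in> lexn r k"
  using F_less[OF assms] assms
  by (simp add: F_eq Cons_in_lexn_Suc_iff length_E del: lexn.simps(2))

lemma G_mono: "x \<in> X \<Longrightarrow> y \<in> X \<Longrightarrow> (x, y) \<in> r \<Longrightarrow> G x = G y \<or> (G x, G y) \<in> r"
  by (auto simp: less_iff)

lemma less_iff_append:
  assumes "x \<in> X" "y \<in> X" "F x = us @ vs" "F y = us' @ vs'" "length us = length us'"
  shows "(x, y) \<in> r \<longleftrightarrow>
    (us, us') \<in> lexn r (length us) \<or> us = us' \<and> (vs, vs') \<in> lexn r (length vs)"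
proof -
  have "length us + length vs = Suc k" "length us' + length vs' = Suc k"
    using F_tuple[OF assms(1)] F_tuple[OF assms(2)] assms(3,4) by (auto simp: tuples_def)
  then have "length vs' = length vs" using assms(5) by simp
  then have "(F x, F y) \<in> lexn r (length us + length vs) \<longleftrightarrow>
      (us, us') \<in> lexn r (length us) \<or> us = us' \<and> (vs, vs') \<in> lexn r (length vs)"
    unfolding assms(3,4) by (intro append_in_lexn_iff) (simp_all add: assms(5))
  then show ?thesis using F_less[OF assms(1,2)] \<open>length us + length vs = Suc k\<close> by simp
qed

section \<open>Cuts at constant sequences\<close>

text \<open>Membership in \<open>below x\<close> means \<open>v < xxx\<dots>\<close>, where \<open>v\<close> is unfolded into an infinite sequence by
  expanding the last coordinate of \<open>F v\<close> again and again.\<close>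

inductive_set below :: "'a \<Rightarrow> 'a set" for x where
  "v \<in> X \<Longrightarrow> (butlast (F v), replicate k x) \<in> lexn r k \<Longrightarrow> v \<in> below x"
| "v \<in> X \<Longrightarrow> butlast (F v) = replicate k x \<Longrightarrow> last (F v) \<in> below x \<Longrightarrow> v \<in> below x"

text \<open>The same cut made in \<open>X \<times> X\<close>: \<open>(m, v)\<close> is read as the
  letter \<open>m\<close> followed by the expansion of \<open>v\<close>, and compared with
  \<open>xxx...\<close>.\<close>

definition below2 :: "'a \<Rightarrow> ('a \<times> 'a) set" where
  "below2 x = {(m, v). (m, x) \<in> r \<or> m = x \<and> v \<in> below x}"

lemma F_butlast_last:
  assumes "v \<in> X"
  shows "F v = butlast (F v) @ [last (F v)]" "length (butlast (F v)) = k" "last (F v) \<in> X"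
    "butlast (F v) \<in> tuples X k"
proof -
  show 1: "F v = butlast (F v) @ [last (F v)]" using F_eq[OF assms] by simp
  have "butlast (F v) @ [last (F v)] \<in> tuples X (Suc k)" using 1 F_tuple[OF assms] by simp
  then show "length (butlast (F v)) = k" "last (F v) \<in> X" "butlast (F v) \<in> tuples X k"
    by (auto simp: tuples_def)
qed

lemma below_iff:
  "v \<in> X \<Longrightarrow> v \<in> below x \<longleftrightarrow> (butlast (F v), replicate k x) \<in> lexn r k \<or>
     butlast (F v) = replicate k x \<and> last (F v) \<in> below x"
  by (subst below.simps) blast

lemma below_in: "v \<in> below x \<Longrightarrow> v \<in> X"
  by (auto elim: below.cases)

lemma less_butlast_last:
  assumes "u \<in> X" "v \<in> X"
  shows "(u, v) \<in> r \<longleftrightarrow> (butlast (F u), butlast (F v)) \<in> lexn r k \<or>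
    butlast (F u) = butlast (F v) \<and> (last (F u), last (F v)) \<in> r"
  using less_iff_append[OF assms F_butlast_last(1)[OF assms(1)] F_butlast_last(1)[OF assms(2)]]
    F_butlast_last(2)[OF assms(1)] F_butlast_last(2)[OF assms(2)]
  by (simp add: singleton_in_lexn_iff del: lexn.simps(2))

text \<open>The derivation records the finite stage at which the expansion of \<open>v\<close> drops
  below \<open>xxx...\<close>. A smaller \<open>u\<close> either drops at the current block or
  follows \<open>v\<close> into the next expansion.\<close>

lemma below_down:
  assumes "v \<in> below x" "u \<in> X" "(u, v) \<in> r"
  shows "u \<in> below x"
  using assms
proof (induction arbitrary: u)
  case (1 v)
  then have "(butlast (F u), replicate k x) \<in> lexn r k"
    using less_butlast_last[of u v] lexn_transI[OF trans, of k] by (metis transD)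
  then show ?case using 1 below_iff by blast
next
  case (2 v)
  then consider (lt) "(butlast (F u), butlast (F v)) \<in> lexn r k"
    | (eq) "butlast (F u) = butlast (F v)" "(last (F u), last (F v)) \<in> r"
    using less_butlast_last[of u v] by blast
  then show ?case
  proof cases
    case lt
    then show ?thesis using 2 below_iff by simp
  next
    case eq
    then have "last (F u) \<in> below x" using 2 F_butlast_last(3) by blast
    then show ?thesis using 2 eq below_iff by simp
  qed
qed

lemma k_Suc: "k = Suc (k - 1)"
  using k by simp

lemma butlast_F: "v \<in> X \<Longrightarrow> butlast (F v) = G v # butlast (E v)"
  using F_eq[of v] length_E[of v] k by auto

lemma below_iff_Cons:
  assumes "v \<in> X"
  shows "v \<in> below x \<longleftrightarrow> (G v, x) \<in> r \<or> G v = x \<and>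
    ((butlast (E v), replicate (k - 1) x) \<in> lexn r (k - 1) \<or>
      butlast (E v) = replicate (k - 1) x \<and> last (F v) \<in> below x)"
proof -
  have rep: "replicate k x = x # replicate (k - 1) x" using k_Suc by (metis replicate_Suc)
  have "(butlast (F v), replicate k x) \<in> lexn r k \<longleftrightarrow>
      (G v # butlast (E v), x # replicate (k - 1) x) \<in> lexn r (Suc (k - 1))"
    using butlast_F[OF assms] rep k_Suc by metis
  also have "\<dots> \<longleftrightarrow> (G v, x) \<in> r \<or> G v = x \<and> (butlast (E v), replicate (k - 1) x) \<in> lexn r (k - 1)"
    by (rule Cons_in_lexn_Suc_iff) (simp_all add: length_E assms)
  finally show ?thesis
    using below_iff[OF assms, of x] butlast_F[OF assms] rep by auto
qed

lemma belowI_G: "v \<in> X \<Longrightarrow> (G v, x) \<in> r \<Longrightarrow> v \<in> below x"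
  by (simp add: below_iff_Cons)

lemma belowD_G: "v \<in> below x \<Longrightarrow> (G v, x) \<in> r \<or> G v = x"
  using below_iff_Cons below_in by blast

lemma below_less:
  assumes "u \<in> below x" "v \<in> X" "v \<notin> below x"
  shows "(u, v) \<in> r"
  using assms below_in below_down less_linear by blast

text \<open>The first letter \<open>G v\<close> is at most \<open>x\<close>, hence strictly below
  \<open>y\<close>, which already decides the comparison with \<open>yyy...\<close>.\<close>

lemma below_mono:
  assumes "(x, y) \<in> r" "v \<in> below x"
  shows "v \<in> below y"
  using belowD_G[OF assms(2)] assms below_in less_trans by (intro belowI_G) blast+

lemma below2_less:
  assumes "p \<in> below2 x" "q \<notin> below2 x" "p \<in> X \<times> X" "q \<in> X \<times> X" "x \<in> X"
  shows "(p, q) \<in> r <*lex*> r"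
proof -
  obtain m v m' v' where eq: "p = (m, v)" "q = (m', v')" by fastforce
  have m': "m' = x \<or> (x, m') \<in> r" using less_linear[of m' x] assms eq unfolding below2_def by blast
  have m: "(m, x) \<in> r \<or> m = x \<and> v \<in> below x" using assms(1) eq unfolding below2_def by simp
  have "v' \<notin> below x" if "m' = x" using assms(2) eq that unfolding below2_def by simp
  then show ?thesis using m m' eq less_trans below_less[of v x v'] assms(4) by auto
qed

lemma below2_down:
  assumes "q \<in> below2 x" "(p, q) \<in> r <*lex*> r" "p \<in> X \<times> X"
  shows "p \<in> below2 x"
  using assms less_trans below_down unfolding below2_def by auto

lemma below2_mono: "(x, y) \<in> r \<Longrightarrow> p \<in> below2 x \<Longrightarrow> p \<in> below2 y"
  using less_trans unfolding below2_def by auto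

lemma irrefl_lex: "irrefl (r <*lex*> r)"
  using less_irrefl by (auto simp: irrefl_def)

lemma trans_lex: "trans (r <*lex*> r)"
  by (intro trans_lex_prod trans)

lemma total_on_lex:
  assumes "A \<subseteq> X \<times> X"
  shows "total_on A (r <*lex*> r)"
  using assms less_linear unfolding total_on_def by (fastforce simp: subset_iff)

text \<open>Prepending \<open>x\<close> fixes \<open>xxx\<dots>\<close> and prepending \<open>k - 1\<close> copies of \<open>y\<close> fixes \<open>yyy\<dots>\<close>. The former map
  embeds the interval between these points of \<open>X\<close> as an initial segment of the corresponding
  interval of \<open>X \<times> X\<close>, the latter embeds as a final segment in the other direction.\<close>

lemma segment_iso:
  assumes x: "x \<in> X" and y: "y \<in> X" and xy: "(x, y) \<in> r"
  shows "order_isomorphic {v\<in>X. v \<notin> below x \<and> v \<in> below y} r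
    {p\<in>X \<times> X. p \<notin> below2 x \<and> p \<in> below2 y} (r <*lex*> r)"
proof -
  define N where "N = {v\<in>X. v \<notin> below x \<and> v \<in> below y}"
  define N2 where "N2 = {p\<in>X \<times> X. p \<notin> below2 x \<and> p \<in> below2 y}"
  define ys where "ys = replicate (k - 1) y"
  define g where "g = (\<lambda>(m, v). mk (ys @ [m, v]))"
  have len_ys: "length ys = k - 1" by (simp add: ys_def)
  have rep: "replicate k y = ys @ [y]"
    unfolding ys_def using k_Suc replicate_append_same[of "k - 1" y] by (metis replicate_Suc)
  have tup: "ys @ [m, v] \<in> tuples X (Suc k)" if "m \<in> X" "v \<in> X" for m v
    using that y k by (auto simp: ys_def tuples_def)
  have gX: "g (m, v) \<in> X" and Fg: "F (g (m, v)) = ys @ [m, v]" if "m \<in> X" "v \<in> X" for m v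
    using mk_in[OF tup[OF that]] F_mk[OF tup[OF that]] by (simp_all add: g_def)
  have kk: "k = (k - 1) + Suc 0" using k by simp
  have lex_k: "(us @ [m], replicate k y) \<in> lexn r k \<longleftrightarrow> (us, ys) \<in> lexn r (k - 1) \<or> us = ys \<and> (m, y) \<in> r"
    if "length us = k - 1" for us m
  proof -
    have "(us @ [m], ys @ [y]) \<in> lexn r ((k - 1) + Suc 0) \<longleftrightarrow>
        (us, ys) \<in> lexn r (k - 1) \<or> us = ys \<and> ([m], [y]) \<in> lexn r (Suc 0)"
      by (rule append_in_lexn_iff) (simp_all add: that len_ys)
    then show ?thesis using kk rep singleton_in_lexn_iff by metis
  qed
  have irr_ys: "(ys, ys) \<notin> lexn r (k - 1)" using irrefl_lexn[OF irr] by (simp add: irrefl_def)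
  \<comment> \<open>The prefix \<open>ys\<close> matches the first \<open>k - 1\<close> letters of
    \<open>yyy...\<close>; what remains is to compare \<open>m\<close> with \<open>y\<close> and
    then \<open>v\<close> with \<open>yyy...\<close>.\<close>
  have g_below: "g (m, v) \<in> below y \<longleftrightarrow> (m, v) \<in> below2 y" if "m \<in> X" "v \<in> X" for m v
  proof -
    have bl: "butlast (F (g (m, v))) = ys @ [m]" "last (F (g (m, v))) = v"
      by (simp_all add: Fg[OF that] butlast_append)
    have "g (m, v) \<in> below y \<longleftrightarrow>
        (ys @ [m], replicate k y) \<in> lexn r k \<or> ys @ [m] = replicate k y \<and> v \<in> below y"
      using below_iff[OF gX[OF that], of y] bl by simp
    also have "\<dots> \<longleftrightarrow> (m, y) \<in> r \<or> m = y \<and> v \<in> below y"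
      using lex_k[OF len_ys, of m] irr_ys rep by simp
    finally show ?thesis by (simp add: below2_def)
  qed
  \<comment> \<open>Since \<open>k - 1\<close> is positive, the first letter of
    \<open>g (m, v)\<close> is \<open>y\<close>, which exceeds \<open>x\<close>.\<close>
  have g_not: "g (m, v) \<notin> below x" if "m \<in> X" "v \<in> X" for m v
  proof
    assume "g (m, v) \<in> below x"
    then have "(G (g (m, v)), x) \<in> r \<or> G (g (m, v)) = x" by (rule belowD_G)
    moreover have "G (g (m, v)) = y"
      using Fg[OF that] k by (cases "k - 1") (auto simp: G_def ys_def)
    ultimately show False using xy less_asym less_irrefl by blast
  qed
  have g_less: "(p, q) \<in> r <*lex*> r \<longleftrightarrow> (g p, g q) \<in> r" if "p \<in> X \<times> X" "q \<in> X \<times> X" for p q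
  proof -
    obtain m v m' v' where eq: "p = (m, v)" "q = (m', v')" by fastforce
    have mv: "m \<in> X" "v \<in> X" "m' \<in> X" "v' \<in> X" using that eq by auto
    have "(g (m, v), g (m', v')) \<in> r \<longleftrightarrow>
        (ys, ys) \<in> lexn r (length ys) \<or> ys = ys \<and> ([m, v], [m', v']) \<in> lexn r (length [m, v])"
      by (rule less_iff_append) (simp_all add: gX Fg mv)
    then show ?thesis
      using irr_ys len_ys eq by (simp add: Cons_in_lexn_Suc_iff singleton_in_lexn_iff del: lexn.simps(2))
  qed
  have "order_isomorphic N r N2 (r <*lex*> r)"
  proof (rule Lindenbaum[where f = "\<lambda>v. (x, v)" and g = g])
    show "irrefl r" "trans r" by (fact irr, fact trans)
    show "total_on N r" using less_linear unfolding total_on_def N_def by blast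
    show "irrefl (r <*lex*> r)" "trans (r <*lex*> r)" by (fact irrefl_lex, fact trans_lex)
    show "total_on N2 (r <*lex*> r)" by (rule total_on_lex) (auto simp: N2_def)
    show "(\<lambda>v. (x, v)) ` N \<subseteq> N2"
      using x xy less_irrefl unfolding N_def N2_def below2_def by auto
    show "(u, v) \<in> r \<longleftrightarrow> ((x, u), (x, v)) \<in> r <*lex*> r" for u v
      using less_irrefl by simp
    \<comment> \<open>A pair in \<open>N2\<close> has first coordinate at least \<open>x\<close>, so
      lying below \<open>(x, v)\<close> forces equality there.\<close>
    show "p \<in> (\<lambda>v. (x, v)) ` N" if v: "v \<in> N" and p: "p \<in> N2" "(p, (x, v)) \<in> r <*lex*> r" for v p
    proof -
      obtain m u where eq: "p = (m, u)" by fastforce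
      have "(m, x) \<notin> r" using p(1) eq unfolding N2_def below2_def by blast
      then have mx: "m = x" "(u, v) \<in> r" using p(2) eq by auto
      then have "u \<notin> below x" "u \<in> X" using p(1) eq unfolding N2_def below2_def by blast+
      then have "u \<in> N" using below_down[of v y u] mx v unfolding N_def by blast
      then show ?thesis using eq mx by blast
    qed
    show "g ` N2 \<subseteq> N" using gX g_below g_not unfolding N_def N2_def by auto
    show "(p, q) \<in> r <*lex*> r \<longleftrightarrow> (g p, g q) \<in> r" if "p \<in> N2" "q \<in> N2" for p q
      using that g_less unfolding N2_def by blast
    \<comment> \<open>The first \<open>k - 1\<close> letters of \<open>w\<close> are at least
      \<open>ys\<close> because \<open>w\<close> is above \<open>g p\<close>, and at most
      \<open>ys\<close> because \<open>w\<close> is below \<open>yyy...\<close>. Hence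
      \<open>w\<close> has the form \<open>g (m', v')\<close>.\<close>
    show "w \<in> g ` N2" if p: "p \<in> N2" and w: "w \<in> N" and pw: "(g p, w) \<in> r" for p w
    proof -
      obtain m v where eq: "p = (m, v)" by fastforce
      have mv: "m \<in> X" "v \<in> X" using p eq unfolding N2_def by auto
      have wX: "w \<in> X" and wy: "w \<in> below y" using w unfolding N_def by auto
      define us where "us = take (k - 1) (F w)"
      have lenF: "length (F w) = Suc k" using F_tuple[OF wX] by (simp add: tuples_def)
      then have len_us: "length us = k - 1" by (simp add: us_def)
      have "length (drop (k - 1) (F w)) = Suc (Suc 0)" using lenF k by simp
      then obtain m' v' where d: "drop (k - 1) (F w) = [m', v']"
        by (metis length_0_conv length_Suc_conv)
      then have Fw: "F w = us @ [m', v']" unfolding us_def by (metis append_take_drop_id)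
      have mv': "m' \<in> X" "v' \<in> X" using F_tuple[OF wX] Fw by (auto simp: tuples_def)
      have "(ys, us) \<in> lexn r (k - 1) \<or> ys = us"
        using less_iff_append[OF gX[OF mv] wX Fg[OF mv] Fw] pw eq len_ys len_us by auto
      moreover have "(us, ys) \<in> lexn r (k - 1) \<or> us = ys"
        using below_iff[OF wX, of y] wy lex_k[OF len_us, of m'] rep Fw by (auto simp: butlast_append)
      ultimately have "us = ys"
        using lexn_transI[OF trans, of "k - 1"] irr_ys by (metis transD)
      then have wg: "w = g (m', v')" using mk_F[OF wX] Fw by (simp add: g_def)
      have "(m', v') \<in> below2 y" using wy wg g_below[OF mv'] by blast
      moreover have "(m', v') \<notin> below2 x"
      proof
        assume "(m', v') \<in> below2 x"
        moreover have "(p, (m', v')) \<in> r <*lex*> r"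
          using g_less[of p "(m', v')"] pw wg mv mv' eq by blast
        ultimately have "p \<in> below2 x" using below2_down p unfolding N2_def by blast
        then show False using p unfolding N2_def by blast
      qed
      ultimately show ?thesis using wg mv' unfolding N2_def by blast
    qed
  qed
  then show ?thesis unfolding N_def N2_def .
qed

section \<open>The preorder of eventual comparison under powers of \<open>G\<close>\<close>

definition le :: "'a \<Rightarrow> 'a \<Rightarrow> bool" where "le x y \<longleftrightarrow> x = y \<or> (x, y) \<in> r"

lemma le_trans: "le x y \<Longrightarrow> le y z \<Longrightarrow> le x z"
  unfolding le_def using less_trans by blast

lemma le_less_trans: "le x y \<Longrightarrow> (y, z) \<in> r \<Longrightarrow> (x, z) \<in> r"
  unfolding le_def using less_trans by blast

lemma less_le_trans: "(x, y) \<in> r \<Longrightarrow> le y z \<Longrightarrow> (x, z) \<in> r"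
  unfolding le_def using less_trans by blast

lemma le_linear: "x \<in> X \<Longrightarrow> y \<in> X \<Longrightarrow> le x y \<or> (y, x) \<in> r"
  unfolding le_def using less_linear by blast

lemma Gn_in: "x \<in> X \<Longrightarrow> (G ^^ n) x \<in> X"
  by (induction n) (auto intro: G_in)

lemma Gn_mono: "x \<in> X \<Longrightarrow> y \<in> X \<Longrightarrow> le x y \<Longrightarrow> le ((G ^^ n) x) ((G ^^ n) y)"
  by (induction n) (use G_mono Gn_in in \<open>auto simp: le_def\<close>)

lemma Gn_less: "x \<in> X \<Longrightarrow> y \<in> X \<Longrightarrow> ((G ^^ n) x, (G ^^ n) y) \<in> r \<Longrightarrow> (x, y) \<in> r"
  using Gn_mono[of y x n] le_linear[of y x] less_irrefl less_le_trans by blast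

lemma G_surj: "\<exists>y\<in>X. G y = w" if "w \<in> X"
proof -
  have "w # replicate k w \<in> tuples X (Suc k)" using that by (auto simp: tuples_def)
  then show ?thesis using G_mk mk_in by blast
qed

lemma Gn_surj: "w \<in> X \<Longrightarrow> \<exists>y\<in>X. (G ^^ n) y = w"
proof (induction n)
  case (Suc n)
  then obtain y where "y \<in> X" "(G ^^ n) y = w" by blast
  moreover obtain y' where "y' \<in> X" "G y' = y" using G_surj \<open>y \<in> X\<close> by blast
  ultimately show ?case by (auto simp: funpow_swap1)
qed auto

definition orbit_le :: "'a \<Rightarrow> 'a \<Rightarrow> bool" where
  "orbit_le x y \<longleftrightarrow> (\<exists>a b. le ((G ^^ a) x) ((G ^^ b) y))"

lemma le_orbit_le: "le x y \<Longrightarrow> orbit_le x y"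
  unfolding orbit_le_def by (metis funpow_0)

text \<open>Monotone powers of \<open>G\<close> bring both inequalities to the common middle term
  \<open>(G ^^ (b + c)) y\<close>.\<close>

lemma orbit_le_trans:
  assumes "orbit_le x y" "orbit_le y z" "x \<in> X" "y \<in> X" "z \<in> X"
  shows "orbit_le x z"
proof -
  obtain a b c d where 1: "le ((G ^^ a) x) ((G ^^ b) y)" and 2: "le ((G ^^ c) y) ((G ^^ d) z)"
    using assms unfolding orbit_le_def by blast
  have "le ((G ^^ (c + a)) x) ((G ^^ (c + b)) y)"
    using Gn_mono[OF Gn_in Gn_in 1, of c] assms by (simp add: funpow_add)
  moreover have "le ((G ^^ (b + c)) y) ((G ^^ (b + d)) z)"
    using Gn_mono[OF Gn_in Gn_in 2, of b] assms by (simp add: funpow_add)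
  ultimately show ?thesis unfolding orbit_le_def using le_trans by (metis add.commute)
qed

definition orbit_class :: "'a \<Rightarrow> 'a set" where
  "orbit_class x = {y\<in>X. orbit_le x y \<and> orbit_le y x}"

lemma orbit_le_G: "orbit_le x (G x)" "orbit_le (G x) x"
proof -
  have "le ((G ^^ 1) x) ((G ^^ 0) (G x))" "le ((G ^^ 0) (G x)) ((G ^^ 1) x)" by (simp_all add: le_def)
  then show "orbit_le x (G x)" "orbit_le (G x) x" unfolding orbit_le_def by blast+
qed

lemma orbit_class_self: "x \<in> X \<Longrightarrow> x \<in> orbit_class x"
  unfolding orbit_class_def using le_orbit_le by (auto simp: le_def)

lemma orbit_class_eq: "x \<in> X \<Longrightarrow> y \<in> orbit_class x \<Longrightarrow> orbit_class y = orbit_class x"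
  unfolding orbit_class_def using orbit_le_trans by blast

text \<open>Invariance in both directions lets \<open>F\<close> restrict to a bijection between a
  class \<open>M\<close> and the words whose first letter lies in \<open>M\<close>.\<close>

lemma orbit_class_G_iff:
  assumes "x \<in> X" "y \<in> X"
  shows "G y \<in> orbit_class x \<longleftrightarrow> y \<in> orbit_class x"
  unfolding orbit_class_def using orbit_le_trans orbit_le_G G_in assms by blast

lemma orbit_class_Gn_iff:
  assumes "x \<in> X" "y \<in> X"
  shows "(G ^^ n) y \<in> orbit_class x \<longleftrightarrow> y \<in> orbit_class x"
  using assms by (induction n) (auto simp: orbit_class_G_iff Gn_in)

text \<open>Otherwise \<open>y'\<close> would be at most \<open>x'\<close>, so \<open>y\<close>
  would precede \<open>x\<close> in the preorder through \<open>y'\<close> and \<open>x'\<close>;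
  with \<open>x\<close> below \<open>y\<close> the two classes would coincide.\<close>

lemma orbit_class_less:
  assumes "x \<in> X" "y \<in> X" "x' \<in> orbit_class x" "y' \<in> orbit_class y" "orbit_class x \<noteq> orbit_class y"
  shows "(x, y) \<in> r \<longleftrightarrow> (x', y') \<in> r"
proof -
  have imp: "(x', y') \<in> r" if "x \<in> X" "y \<in> X" "x' \<in> orbit_class x" "y' \<in> orbit_class y"
    "orbit_class x \<noteq> orbit_class y" "(x, y) \<in> r" for x y x' y'
  proof (rule ccontr)
    assume "(x', y') \<notin> r"
    moreover have X': "x' \<in> X" "y' \<in> X" using that unfolding orbit_class_def by auto
    ultimately have "orbit_le y' x'" using less_linear le_orbit_le unfolding le_def by blast
    moreover have "orbit_le x y" using that le_orbit_le unfolding le_def by blast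
    moreover have "orbit_le y y'" "orbit_le x' x" using that unfolding orbit_class_def by auto
    ultimately have "orbit_le y x" using orbit_le_trans that X' by blast
    then have "y \<in> orbit_class x" using \<open>orbit_le x y\<close> that unfolding orbit_class_def by blast
    then show False using orbit_class_eq that by blast
  qed
  have X': "x' \<in> X" "y' \<in> X" using assms unfolding orbit_class_def by auto
  have eq: "orbit_class x' = orbit_class x" "orbit_class y' = orbit_class y"
    by (rule orbit_class_eq[OF assms(1,3)], rule orbit_class_eq[OF assms(2,4)])
  show ?thesis
    using imp[of x y x' y'] imp[of x' y' x y] assms X' eq orbit_class_self by blast
qed

lemma orbit_class_subset: "orbit_class x \<subseteq> X"
  unfolding orbit_class_def by blast

lemma orbit_class_Gn_surj:
  assumes "x \<in> X" "w \<in> orbit_class x"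
  shows "\<exists>y\<in>orbit_class x. (G ^^ n) y = w"
  using Gn_surj[of w n] orbit_class_Gn_iff[of x _ n] assms orbit_class_subset by blast

section \<open>Classes without endpoints\<close>

text \<open>The first letter decides the cut unless it equals \<open>x\<close>. Together with
  \<open>below_compare\<close> this shows that cuts along a sequence unbounded both ways in a class
  \<open>M\<close> isolate exactly the pairs with \<open>m\<close> in \<open>M\<close> and the
  \<open>v\<close> with \<open>G v\<close> in \<open>M\<close>.\<close>

lemma below2_compare:
  assumes "x \<in> X" "m \<in> X"
  shows "(m, x) \<in> r \<Longrightarrow> (m, v) \<in> below2 x" "(x, m) \<in> r \<Longrightarrow> (m, v) \<notin> below2 x"
    "(m, v) \<in> below2 x \<Longrightarrow> le m x" "(m, v) \<notin> below2 x \<Longrightarrow> le x m"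
  using assms less_asym less_irrefl less_linear[of m x] unfolding below2_def le_def by auto

lemma below_compare:
  assumes "x \<in> X" "v \<in> X"
  shows "(G v, x) \<in> r \<Longrightarrow> v \<in> below x" "(x, G v) \<in> r \<Longrightarrow> v \<notin> below x"
    "v \<in> below x \<Longrightarrow> le (G v) x" "v \<notin> below x \<Longrightarrow> le x (G v)"
  using assms less_asym less_irrefl less_linear[of "G v" x] belowI_G[of v x] belowD_G[of v x] G_in
  unfolding le_def by auto

text \<open>Each element is labelled by the set of indices whose cut lies above it. The fibres are
  the segments between consecutive cuts, handled by \<open>segment_iso\<close>, and gluing joins
  them.\<close>

lemma int_sequence_iso:
  fixes a :: "int \<Rightarrow> 'a"
  assumes aX: "\<And>i. a i \<in> X" and a: "\<And>i. (a i, a (i + 1)) \<in> r"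
  shows "order_isomorphic {v\<in>X. (\<exists>i. v \<notin> below (a i)) \<and> (\<exists>i. v \<in> below (a i))} r
    {p\<in>X \<times> X. (\<exists>i. p \<notin> below2 (a i)) \<and> (\<exists>i. p \<in> below2 (a i))} (r <*lex*> r)"
proof -
  define A where "A = {v\<in>X. (\<exists>i. v \<notin> below (a i)) \<and> (\<exists>i. v \<in> below (a i))}"
  define B where "B = {p\<in>X \<times> X. (\<exists>i. p \<notin> below2 (a i)) \<and> (\<exists>i. p \<in> below2 (a i))}"
  define c where "c v = {i. v \<in> below (a i)}" for v
  define c' where "c' p = {i. p \<in> below2 (a i)}" for p
  define N where "N i = {v\<in>X. v \<notin> below (a i) \<and> v \<in> below (a (i + 1))}" for i
  define N2 where "N2 i = {p\<in>X \<times> X. p \<notin> below2 (a i) \<and> p \<in> below2 (a (i + 1))}" for i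
  have iso: "order_isomorphic (N i) r (N2 i) (r <*lex*> r)" for i
    unfolding N_def N2_def by (rule segment_iso[OF aX aX a])
  have cA: "\<exists>n. c v = {n<..}" if "v \<in> A" for v
    using that int_crossing[of "\<lambda>i. v \<in> below (a i)"] below_mono[OF a] unfolding c_def A_def by blast
  have cB: "\<exists>n. c' p = {n<..}" if "p \<in> B" for p
    using that int_crossing[of "\<lambda>i. p \<in> below2 (a i)"] below2_mono[OF a] unfolding c'_def B_def by blast
  have cut: "{m<..} = {n<..} \<longleftrightarrow> n \<notin> {m<..} \<and> n + 1 \<in> {m<..}" for m n :: int by auto
  have fibA: "{v\<in>A. c v = {n<..}} = N n" for n
  proof -
    have "N n \<subseteq> A" unfolding N_def A_def by blast
    moreover have "c v = {n<..} \<longleftrightarrow> v \<in> N n" if v: "v \<in> A" for v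
    proof -
      have "c v = {n<..} \<longleftrightarrow> n \<notin> c v \<and> n + 1 \<in> c v" using cA[OF v] cut by metis
      then show ?thesis using v unfolding N_def c_def A_def by simp
    qed
    ultimately show ?thesis by blast
  qed
  have fibB: "{p\<in>B. c' p = {n<..}} = N2 n" for n
  proof -
    have "N2 n \<subseteq> B" unfolding N2_def B_def by blast
    moreover have "c' p = {n<..} \<longleftrightarrow> p \<in> N2 n" if p: "p \<in> B" for p
    proof -
      have "c' p = {n<..} \<longleftrightarrow> n \<notin> c' p \<and> n + 1 \<in> c' p" using cB[OF p] cut by metis
      then show ?thesis using p unfolding N2_def c'_def B_def by simp
    qed
    ultimately show ?thesis by blast
  qed
  \<comment> \<open>Corresponding segments may be empty, but only together; hence the same labels
    occur on both sides.\<close>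
  have empty: "N n = {} \<longleftrightarrow> N2 n = {}" for n
    using iso[of n] unfolding order_isomorphic_def bij_betw_def by blast
  have "order_isomorphic A r B (r <*lex*> r)"
  proof (rule order_isomorphic_glue[where c = c and c' = c'])
    show "c ` A = c' ` B"
    proof
      show "c ` A \<subseteq> c' ` B"
      proof
        fix i assume "i \<in> c ` A"
        then obtain v where v: "v \<in> A" "i = c v" by blast
        then obtain n where n: "c v = {n<..}" using cA by blast
        then have "N n \<noteq> {}" using fibA[of n] v by blast
        then have "{p\<in>B. c' p = {n<..}} \<noteq> {}" using empty fibB[of n] by simp
        then show "i \<in> c' ` B" using n v by blast
      qed
      show "c' ` B \<subseteq> c ` A"
      proof
        fix i assume "i \<in> c' ` B"
        then obtain p where p: "p \<in> B" "i = c' p" by blast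
        then obtain n where n: "c' p = {n<..}" using cB by blast
        then have "N2 n \<noteq> {}" using fibB[of n] p by blast
        then have "{v\<in>A. c v = {n<..}} \<noteq> {}" using empty fibA[of n] by simp
        then show "i \<in> c ` A" using n p by blast
      qed
    qed
    fix i assume "i \<in> c ` A"
    then obtain n where n: "i = {n<..}" using cA by blast
    show "order_isomorphic {v\<in>A. c v = i} r {p\<in>B. c' p = i} (r <*lex*> r)"
      unfolding n fibA fibB by (rule iso)
  next
    fix v v' p p'
    assume vp: "v \<in> A" "v' \<in> A" "p \<in> B" "p' \<in> B" "c v = c' p" "c v' = c' p'" "c v \<noteq> c v'"
    have X: "v \<in> X" "v' \<in> X" "p \<in> X \<times> X" "p' \<in> X \<times> X" using vp(1-4) unfolding A_def B_def by blast+
    \<comment> \<open>An index in one label but not in the other names a cut that separates both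
      pairs in the same direction.\<close>
    consider (lt) i where "i \<in> c v" "i \<notin> c v'" | (gt) i where "i \<notin> c v" "i \<in> c v'" using vp(7) by blast
    then show "(v, v') \<in> r \<longleftrightarrow> (p, p') \<in> r <*lex*> r"
    proof cases
      case lt
      then have "i \<in> c' p" "i \<notin> c' p'" using vp(5,6) by auto
      then have "(p, p') \<in> r <*lex*> r" using X aX below2_less unfolding c'_def by blast
      moreover have "(v, v') \<in> r" using lt X below_less unfolding c_def by blast
      ultimately show ?thesis by blast
    next
      case gt
      then have "i \<notin> c' p" "i \<in> c' p'" using vp(5,6) by auto
      then have "(p', p) \<in> r <*lex*> r" using X aX below2_less unfolding c'_def by blast
      then have "(p, p') \<notin> r <*lex*> r"
        using irrefl_lex transD[OF trans_lex] unfolding irrefl_def by blast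
      moreover have "(v', v) \<in> r" using gt X below_less unfolding c_def by blast
      ultimately show ?thesis using less_asym by blast
    qed
  qed
  then show ?thesis unfolding A_def B_def .
qed

lemma orbit_class_convex:
  assumes "x \<in> X" "u \<in> orbit_class x" "w \<in> orbit_class x" "v \<in> X" "le u v" "le v w"
  shows "v \<in> orbit_class x"
proof -
  have "u \<in> X" "w \<in> X" "orbit_le x u" "orbit_le w x" using assms unfolding orbit_class_def by auto
  then have "orbit_le x v" "orbit_le v x"
    using orbit_le_trans[of x u v] orbit_le_trans[of v w x] le_orbit_le assms by blast+
  then show ?thesis using assms unfolding orbit_class_def by blast
qed

text \<open>Keeping \<open>G y\<close> and varying the other coordinates gives a copy of
  \<open>X^k\<close> inside the class, so an extremal \<open>y\<close> of the class has an extremal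
  \<open>E y\<close>.\<close>

lemma orbit_class_fibre:
  assumes "x \<in> X" "y \<in> orbit_class x" "es \<in> tuples X k"
  shows "mk (G y # es) \<in> orbit_class x" "(y, mk (G y # es)) \<in> r \<longleftrightarrow> (E y, es) \<in> lexn r k"
    "(mk (G y # es), y) \<in> r \<longleftrightarrow> (es, E y) \<in> lexn r k"
proof -
  have y: "y \<in> X" using assms orbit_class_subset by blast
  have t: "G y # es \<in> tuples X (Suc k)" using G_in[OF y] assms by (auto simp: tuples_def)
  have X: "mk (G y # es) \<in> X" by (rule mk_in[OF t])
  show "mk (G y # es) \<in> orbit_class x"
    using orbit_class_G_iff[OF assms(1) X] orbit_class_G_iff[OF assms(1) y] G_mk[OF t] assms by simp
  show "(y, mk (G y # es)) \<in> r \<longleftrightarrow> (E y, es) \<in> lexn r k"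
    "(mk (G y # es), y) \<in> r \<longleftrightarrow> (es, E y) \<in> lexn r k"
    using less_iff[OF y X] less_iff[OF X y] G_mk[OF t] E_mk[OF t] less_irrefl by simp_all
qed

lemma orbit_class_no_max:
  assumes no_max: "\<And>x. x \<in> X \<Longrightarrow> \<exists>y\<in>X. (x, y) \<in> r" and x: "x \<in> X" and y: "y \<in> orbit_class x"
  shows "\<exists>y'\<in>orbit_class x. (y, y') \<in> r"
proof -
  have yX: "y \<in> X" using y orbit_class_subset by blast
  obtain e es where E: "E y = e # es" using length_E[OF yX] k by (cases "E y") auto
  have e: "e \<in> X" "es \<in> lists X" "Suc (length es) = k" using E_in[OF yX] E by (auto simp: tuples_def)
  \<comment> \<open>Raising the first letter of \<open>E y\<close> while keeping \<open>G y\<close>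
    moves up inside the class.\<close>
  obtain e' where e': "e' \<in> X" "(e, e') \<in> r" using no_max e by blast
  have "e' # es \<in> tuples X k" using e e' by (auto simp: tuples_def)
  moreover have "(e # es, e' # es) \<in> lexn r (Suc (length es))"
    using e' by (simp add: Cons_in_lexn_Suc_iff del: lexn.simps(2))
  ultimately show ?thesis using orbit_class_fibre[OF x y] E e by metis
qed

text \<open>A class without endpoints has countable cofinality and coinitiality: every element is dominated
  by one of the countably many conditions \<open>G\<^sup>a y \<le> G\<^sup>b x\<close>.\<close>

lemma orbit_class_iso_unbounded:
  assumes x: "x \<in> X"
    and no_max: "\<And>y. y \<in> orbit_class x \<Longrightarrow> \<exists>y'\<in>orbit_class x. (y, y') \<in> r"
    and no_min: "\<And>y. y \<in> orbit_class x \<Longrightarrow> \<exists>y'\<in>orbit_class x. (y', y) \<in> r"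
  shows "order_isomorphic (orbit_class x) r (orbit_class x \<times> X) (r <*lex*> r)"
proof -
  define M where "M = orbit_class x"
  have MX: "M \<subseteq> X" unfolding M_def by (rule orbit_class_subset)
  have xM: "x \<in> M" unfolding M_def by (rule orbit_class_self[OF x])
  have GxM: "(G ^^ b) x \<in> M" for b using orbit_class_Gn_iff[OF x x] xM unfolding M_def by simp
  \<comment> \<open>One element dominates all \<open>y\<close> satisfying the condition for
    \<open>(a, b)\<close>: go strictly above \<open>(G ^^ b) x\<close> within the class and pull
    back along \<open>G ^^ a\<close>, which reflects strict inequalities.\<close>
  have "\<exists>w\<in>M. \<forall>y\<in>M. le ((G ^^ a) y) ((G ^^ b) x) \<longrightarrow> (y, w) \<in> r" for a b
  proof -
    obtain w1 where w1: "w1 \<in> M" "((G ^^ b) x, w1) \<in> r" using no_max GxM unfolding M_def by blast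
    obtain w where w: "w \<in> M" "(G ^^ a) w = w1"
      using orbit_class_Gn_surj[OF x] w1 unfolding M_def by blast
    have "(y, w) \<in> r" if "y \<in> M" "le ((G ^^ a) y) ((G ^^ b) x)" for y
      using le_less_trans[OF that(2) w1(2)] w MX that by (intro Gn_less[of y w a]) auto
    then show ?thesis using w by blast
  qed
  then have "\<forall>a b. \<exists>w. w \<in> M \<and> (\<forall>y\<in>M. le ((G ^^ a) y) ((G ^^ b) x) \<longrightarrow> (y, w) \<in> r)" by blast
  then obtain w where w: "\<And>a b. w a b \<in> M"
    "\<And>a b y. y \<in> M \<Longrightarrow> le ((G ^^ a) y) ((G ^^ b) x) \<Longrightarrow> (y, w a b) \<in> r"
    unfolding choice_iff by blast
  have "\<exists>w\<in>M. \<forall>y\<in>M. le ((G ^^ b) x) ((G ^^ a) y) \<longrightarrow> (w, y) \<in> r" for a b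
  proof -
    obtain w1 where w1: "w1 \<in> M" "(w1, (G ^^ b) x) \<in> r" using no_min GxM unfolding M_def by blast
    obtain w where w: "w \<in> M" "(G ^^ a) w = w1"
      using orbit_class_Gn_surj[OF x] w1 unfolding M_def by blast
    have "(w, y) \<in> r" if "y \<in> M" "le ((G ^^ b) x) ((G ^^ a) y)" for y
      using less_le_trans[OF w1(2) that(2)] w MX that by (intro Gn_less[of w y a]) auto
    then show ?thesis using w by blast
  qed
  then have "\<forall>a b. \<exists>w. w \<in> M \<and> (\<forall>y\<in>M. le ((G ^^ b) x) ((G ^^ a) y) \<longrightarrow> (w, y) \<in> r)" by blast
  then obtain w' where w': "\<And>a b. w' a b \<in> M"
    "\<And>a b y. y \<in> M \<Longrightarrow> le ((G ^^ b) x) ((G ^^ a) y) \<Longrightarrow> (w' a b, y) \<in> r"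
    unfolding choice_iff by blast
  have total_M: "total_on M r" "total_on M (r\<inverse>)"
    using less_linear MX unfolding total_on_def by blast+
  \<comment> \<open>\<open>prod_decode\<close> runs through all pairs of exponents, so
    \<open>u\<close> passes every \<open>w a b\<close> and is cofinal in \<open>M\<close>. The
    sequence \<open>d\<close> below is obtained in the same way from the reversed order.\<close>
  obtain u where u: "u 0 = x" "\<And>n. u n \<in> M" "\<And>n. (u n, u (Suc n)) \<in> r"
    "\<And>n. (case_prod w (prod_decode n), u (Suc n)) \<in> r"
    using increasing_sequence_above[OF trans total_M(1) xM, of "\<lambda>n. case_prod w (prod_decode n)"]
      w(1) no_max unfolding M_def by (metis (no_types, lifting) case_prod_beta)
  have "trans (r\<inverse>)" using trans by simp
  moreover have "case_prod w' (prod_decode n) \<in> M" for n using w'(1) by (simp add: case_prod_beta)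
  moreover have "\<exists>y\<in>M. (z, y) \<in> r\<inverse>" if "z \<in> M" for z using no_min that unfolding M_def by blast
  ultimately have d_ex: "\<exists>d. d 0 = x \<and> (\<forall>n. d n \<in> M \<and> (d n, d (Suc n)) \<in> r\<inverse> \<and>
      (case_prod w' (prod_decode n), d (Suc n)) \<in> r\<inverse>)"
    using total_M(2) xM by (intro increasing_sequence_above)
  obtain d where d: "d 0 = x" "\<And>n. d n \<in> M" "\<And>n. (d (Suc n), d n) \<in> r"
    "\<And>n. (d (Suc n), case_prod w' (prod_decode n)) \<in> r"
    using d_ex by auto
  define a where "a i = (if 0 \<le> i then u (nat i) else d (nat (- i)))" for i :: int
  have aM: "a i \<in> M" for i using u(2) d(2) by (simp add: a_def)
  have aX: "a i \<in> X" for i using aM MX by blast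
  have a_pos: "a (int n) = u n" for n by (simp add: a_def)
  \<comment> \<open>Both sequences start at \<open>x\<close>, so this also holds at index 0, where
    the two halves meet.\<close>
  have a_neg: "a (- int n) = d n" for n using u(1) d(1) by (simp add: a_def)
  have a_less: "(a i, a (i + 1)) \<in> r" for i
  proof (cases "0 \<le> i")
    case True
    then obtain n where "i = int n" "i + 1 = int (Suc n)" by (metis nonneg_int_cases of_nat_Suc add.commute)
    then show ?thesis using u(3)[of n] a_pos by metis
  next
    case False
    then obtain n where n: "i = - int (Suc n)" by (metis linorder_not_le negD)
    then have "i + 1 = - int n" by simp
    then show ?thesis using d(3)[of n] a_neg n by metis
  qed
  have above: "\<exists>i. (y, a i) \<in> r" if y: "y \<in> M" for y
  proof -
    obtain b c where "le ((G ^^ b) y) ((G ^^ c) x)"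
      using y unfolding M_def orbit_class_def orbit_le_def by blast
    then have "(y, w b c) \<in> r" using w(2) y by blast
    moreover have "(w b c, u (Suc (prod_encode (b, c)))) \<in> r"
      using u(4)[of "prod_encode (b, c)"] by simp
    ultimately have "(y, u (Suc (prod_encode (b, c)))) \<in> r" using less_trans by blast
    then have "(y, a (int (Suc (prod_encode (b, c))))) \<in> r" unfolding a_pos .
    then show ?thesis by blast
  qed
  have bel: "\<exists>i. (a i, y) \<in> r" if y: "y \<in> M" for y
  proof -
    obtain b c where "le ((G ^^ c) x) ((G ^^ b) y)"
      using y unfolding M_def orbit_class_def orbit_le_def by blast
    then have "(w' b c, y) \<in> r" using w'(2) y by blast
    moreover have "(d (Suc (prod_encode (b, c))), w' b c) \<in> r"
      using d(4)[of "prod_encode (b, c)"] by simp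
    ultimately have "(d (Suc (prod_encode (b, c))), y) \<in> r" using less_trans by blast
    then have "(a (- int (Suc (prod_encode (b, c)))), y) \<in> r" unfolding a_neg .
    then show ?thesis by blast
  qed
  have conv: "v \<in> M" if "v \<in> X" "le (a i) v" "le v (a j)" for v i j
    using orbit_class_convex[OF x _ _ that] aM unfolding M_def by blast
  have "{v\<in>X. (\<exists>i. v \<notin> below (a i)) \<and> (\<exists>i. v \<in> below (a i))} = M" (is "?L = M")
  proof
    show "?L \<subseteq> M"
    proof
      fix v assume "v \<in> ?L"
      then obtain i j where v: "v \<in> X" "v \<notin> below (a i)" "v \<in> below (a j)" by blast
      then have "G v \<in> M" using below_compare[OF aX v(1)] conv G_in by blast
      then show "v \<in> M" using orbit_class_G_iff[OF x v(1)] unfolding M_def by blast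
    qed
    show "M \<subseteq> ?L"
    proof
      fix v assume v: "v \<in> M"
      then have vX: "v \<in> X" using MX by blast
      then have "G v \<in> M" using v orbit_class_G_iff[OF x vX] unfolding M_def by blast
      then obtain i j where "(G v, a i) \<in> r" "(a j, G v) \<in> r" using above bel by blast
      then show "v \<in> ?L" using below_compare(1,2)[OF aX vX] vX by blast
    qed
  qed
  moreover have "{p\<in>X \<times> X. (\<exists>i. p \<notin> below2 (a i)) \<and> (\<exists>i. p \<in> below2 (a i))} = M \<times> X" (is "?L = _")
  proof
    show "?L \<subseteq> M \<times> X"
    proof
      fix p assume p: "p \<in> ?L"
      obtain m v where eq: "p = (m, v)" by fastforce
      then obtain i j where mv: "m \<in> X" "v \<in> X" "(m, v) \<notin> below2 (a i)" "(m, v) \<in> below2 (a j)"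
        using p by blast
      then have "m \<in> M" using below2_compare[OF aX mv(1)] conv by blast
      then show "p \<in> M \<times> X" using eq mv by blast
    qed
    show "M \<times> X \<subseteq> ?L"
    proof
      fix p assume p: "p \<in> M \<times> X"
      obtain m v where eq: "p = (m, v)" by fastforce
      have m: "m \<in> M" "m \<in> X" "v \<in> X" using p eq MX by auto
      then obtain i j where "(m, a i) \<in> r" "(a j, m) \<in> r" using above bel by blast
      then show "p \<in> ?L" using below2_compare(1,2)[OF aX m(2)] m eq by blast
    qed
  qed
  ultimately show ?thesis
    using int_sequence_iso[of a, OF aX a_less] unfolding M_def by simp
qed

section \<open>Classes with a minimum\<close>

text \<open>Both sides are coded by sequences of digits in \<open>X^k\<close> that are eventually
  \<open>E z\<close>. On the class, \<open>G\<close> forgets \<open>k\<close> letters at a time.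
  Expanding the first entry of a pair gives \<open>k + 2\<close> letters, and forgetting the last
  \<open>k\<close> leaves a pair again.\<close>

lemma orbit_class_iso_min:
  assumes x: "x \<in> X" and z: "z \<in> orbit_class x"
    and min: "\<And>y. y \<in> orbit_class x \<Longrightarrow> (y, z) \<notin> r"
  shows "order_isomorphic (orbit_class x) r (orbit_class x \<times> X) (r <*lex*> r)"
proof -
  define M where "M = orbit_class x"
  have MX: "M \<subseteq> X" unfolding M_def by (rule orbit_class_subset)
  have zM: "z \<in> M" and zX: "z \<in> X" using z MX unfolding M_def by auto
  have GM: "G y \<in> M" if "y \<in> M" for y
    using orbit_class_G_iff[OF x] that MX unfolding M_def by blast
  have mk_M: "mk (m # es) \<in> M" if m: "m \<in> M" and es: "es \<in> tuples X k" for m es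
  proof -
    have t: "m # es \<in> tuples X (Suc k)" using m es MX by (auto simp: tuples_def)
    show ?thesis
      using orbit_class_G_iff[OF x mk_in[OF t]] G_mk[OF t] m unfolding M_def by simp
  qed
  \<comment> \<open>The minimum has a \<open>G\<close>-preimage \<open>y\<close> in the class, and
    \<open>y\<close> is at least \<open>z\<close>; so \<open>G z\<close> is at most
    \<open>G y = z\<close>, and minimality gives equality.\<close>
  have Gz: "G z = z"
  proof -
    obtain y where y: "y \<in> M" "(G ^^ 1) y = z"
      using orbit_class_Gn_surj[OF x z, of 1] unfolding M_def by blast
    then have "le z y" using min[of y] le_linear[of z y] MX zX unfolding M_def by blast
    then have "le (G z) z" using Gn_mono[of z y 1] y MX zX by auto
    moreover have "(G z, z) \<notin> r" using min GM[OF zM] unfolding M_def by blast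
    ultimately show ?thesis unfolding le_def by blast
  qed
  have Gnz: "(G ^^ n) z = z" for n using Gz by (induction n) auto
  have ev: "\<exists>n. (G ^^ n) y = z" if y: "y \<in> M" for y
  proof -
    have "orbit_le y z"
      using y z orbit_class_eq[OF x z] unfolding M_def orbit_class_def by blast
    then obtain a b where ab: "le ((G ^^ a) y) ((G ^^ b) z)" unfolding orbit_le_def by blast
    have "(G ^^ a) y \<in> M" using orbit_class_Gn_iff[OF x] y MX unfolding M_def by blast
    then have "((G ^^ a) y, z) \<notin> r" using min unfolding M_def by blast
    then show ?thesis using ab Gnz unfolding le_def by auto
  qed
  obtain o' es where E: "E z = o' # es" using length_E[OF zX] k by (cases "E z") auto
  have o: "o' \<in> X" "es \<in> lists X" "Suc (length es) = k" using E_in[OF zX] E by (auto simp: tuples_def)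
  have E_min: "(fs, E z) \<notin> lexn r k" if "fs \<in> tuples X k" for fs
    using orbit_class_fibre[OF x z that] min by blast
  \<comment> \<open>Lowering the first letter of \<open>E z\<close> would give an element of the
    class below \<open>z\<close>.\<close>
  have o_min: "(v, o') \<notin> r" if "v \<in> X" for v
  proof
    assume "(v, o') \<in> r"
    then have "(v # es, o' # es) \<in> lexn r (Suc (length es))"
      by (simp add: Cons_in_lexn_Suc_iff del: lexn.simps(2))
    then show False using E_min[of "v # es"] that o E by (auto simp: tuples_def)
  qed
  \<comment> \<open>\<open>E z\<close> is least in \<open>X^k\<close>, hence constant. This makes
    the default digits of the two codings agree: \<open>E2 (z, o')\<close> drops the first letter of
    \<open>E z\<close> and appends \<open>o'\<close>.\<close>
  have Ez: "E z = replicate k o'"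
  proof (rule ccontr)
    assume "E z \<noteq> replicate k o'"
    moreover have rep: "replicate k o' \<in> tuples X k" using o by (auto simp: tuples_def)
    ultimately have "(E z, replicate k o') \<in> lexn r k"
      using total_on_tuples[OF total, of k] E_in[OF zX] E_min[OF rep] unfolding total_on_def by blast
    then obtain us a b as bs where *: "E z = us @ a # as" "replicate k o' = us @ b # bs" "(a, b) \<in> r"
      unfolding lexn_conv by blast
    have "b \<in> set (replicate k o')" using *(2) by simp
    then have "b = o'" by (simp split: if_splits)
    moreover have "a \<in> X" using E_in[OF zX] *(1) by (auto simp: tuples_def)
    ultimately show False using *(3) o_min by blast
  qed
  have irr_T: "irrefl (lexn r k)" by (rule irrefl_lexn[OF irr])
  have iso1: "order_isomorphic M r (digit_seqs (tuples X k) (E z)) (digit_less (lexn r k))"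
  proof (rule order_isomorphic_digit_seqs[where G = G and e = E])
    show "irrefl r" "irrefl (lexn r k)" by (fact irr, fact irr_T)
    show "bij_betw (\<lambda>y. (G y, E y)) M (M \<times> tuples X k)"
    proof (rule bij_betw_byWitness[where f' = "\<lambda>(m, es). mk (m # es)"])
      show "\<forall>y\<in>M. (case (G y, E y) of (m, es) \<Rightarrow> mk (m # es)) = y"
        using MX F_eq mk_F by auto
      show "\<forall>p\<in>M \<times> tuples X k. (G (case p of (m, es) \<Rightarrow> mk (m # es)), E (case p of (m, es) \<Rightarrow> mk (m # es))) = p"
        using MX by (auto simp: tuples_def intro!: G_mk E_mk)
      show "(\<lambda>y. (G y, E y)) ` M \<subseteq> M \<times> tuples X k" using GM E_in MX by auto
      show "(\<lambda>(m, es). mk (m # es)) ` (M \<times> tuples X k) \<subseteq> M" using mk_M by auto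
    qed
    show "(y, y') \<in> r \<longleftrightarrow> (G y, G y') \<in> r \<or> G y = G y' \<and> (E y, E y') \<in> lexn r k"
      if "y \<in> M" "y' \<in> M" for y y' using less_iff that MX by blast
    show "z \<in> M" "G z = z" by (fact zM, fact Gz)
    show "\<exists>n. (G ^^ n) y = z" if "y \<in> M" for y by (rule ev[OF that])
  qed
  \<comment> \<open>With \<open>E y = h # t\<close>, the pair \<open>(y, v)\<close> expands to the
    letters \<open>G y, h, t, v\<close>. \<open>G2\<close> keeps the first two, \<open>E2\<close>
    the remaining \<open>k\<close>, and \<open>W\<close> reassembles them.\<close>
  define G2 where "G2 p = (G (fst p), hd (E (fst p)))" for p :: "'a \<times> 'a"
  define E2 where "E2 p = tl (E (fst p)) @ [snd p]" for p
  define W where "W = (\<lambda>((m, h), es). (mk (m # h # butlast es), last es))"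
  have E2z: "E2 (z, o') = E z"
    using k_Suc by (cases k) (simp_all add: E2_def Ez replicate_append_same)
  have E_Cons: "\<exists>h t. E y = h # t \<and> h \<in> X \<and> t \<in> lists X \<and> length t = k - 1" if "y \<in> X" for y
    using E_in[OF that] k by (cases "E y") (auto simp: tuples_def)
  have iso2: "order_isomorphic (M \<times> X) (r <*lex*> r) (digit_seqs (tuples X k) (E2 (z, o'))) (digit_less (lexn r k))"
  proof (rule order_isomorphic_digit_seqs[where G = G2 and e = E2])
    show "irrefl (r <*lex*> r)" "irrefl (lexn r k)" by (fact irrefl_lex, fact irr_T)
    show "bij_betw (\<lambda>p. (G2 p, E2 p)) (M \<times> X) ((M \<times> X) \<times> tuples X k)"
    proof (rule bij_betw_byWitness[where f' = W])
      show "\<forall>p\<in>M \<times> X. W (G2 p, E2 p) = p"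
      proof
        fix p assume "p \<in> M \<times> X"
        then obtain y v where p: "p = (y, v)" "y \<in> X" using MX by blast
        obtain h t where ht: "E y = h # t" using E_Cons[OF p(2)] by blast
        have "mk (G y # h # t) = y" using mk_F[OF p(2)] F_eq[OF p(2)] ht by simp
        then show "W (G2 p, E2 p) = p"
          using p ht by (simp add: G2_def E2_def W_def)
      qed
      have tup: "m # h # butlast es \<in> tuples X (Suc k)" and es: "es \<noteq> []" "last es \<in> X"
        "h # butlast es \<in> tuples X k"
        if "m \<in> M" "h \<in> X" "es \<in> tuples X k" for m h es
      proof -
        show "es \<noteq> []" using that k by (auto simp: tuples_def)
        then show "last es \<in> X" using that by (auto simp: tuples_def in_lists_conv_set)
        show "h # butlast es \<in> tuples X k"
          using that k by (auto simp: tuples_def in_lists_conv_set dest: in_set_butlastD)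
        then show "m # h # butlast es \<in> tuples X (Suc k)" using that MX by (auto simp: tuples_def)
      qed
      show "\<forall>q\<in>(M \<times> X) \<times> tuples X k. (G2 (W q), E2 (W q)) = q"
      proof
        fix q assume "q \<in> (M \<times> X) \<times> tuples X k"
        then obtain m h es where q: "q = ((m, h), es)" "m \<in> M" "h \<in> X" "es \<in> tuples X k" by auto
        show "(G2 (W q), E2 (W q)) = q"
          using G_mk[OF tup[OF q(2-4)]] E_mk[OF tup[OF q(2-4)]] es(1)[OF q(2-4)] q(1)
          by (simp add: G2_def E2_def W_def)
      qed
      show "(\<lambda>p. (G2 p, E2 p)) ` (M \<times> X) \<subseteq> (M \<times> X) \<times> tuples X k"
      proof
        fix q assume "q \<in> (\<lambda>p. (G2 p, E2 p)) ` (M \<times> X)"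
        then obtain y v where q: "q = (G2 (y, v), E2 (y, v))" "y \<in> M" "v \<in> X" by auto
        obtain h t where ht: "E y = h # t" "h \<in> X" "t \<in> lists X" "length t = k - 1"
          using E_Cons q(2) MX by blast
        have "t @ [v] \<in> tuples X k" using ht q(3) k by (auto simp: tuples_def)
        then show "q \<in> (M \<times> X) \<times> tuples X k"
          using q ht GM by (simp add: G2_def E2_def)
      qed
      show "W ` ((M \<times> X) \<times> tuples X k) \<subseteq> M \<times> X"
        using mk_M es by (auto simp: W_def)
    qed
    show "(p, q) \<in> r <*lex*> r \<longleftrightarrow>
        (G2 p, G2 q) \<in> r <*lex*> r \<or> G2 p = G2 q \<and> (E2 p, E2 q) \<in> lexn r k"
      if pM: "p \<in> M \<times> X" and qM: "q \<in> M \<times> X" for p q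
    proof -
      obtain y v where p: "p = (y, v)" "y \<in> X" using pM MX by blast
      obtain y' v' where q: "q = (y', v')" "y' \<in> X" using qM MX by blast
      note pq = p(1) q(1) p(2) q(2)
      obtain h t where ht: "E y = h # t" "length t = k - 1" using E_Cons[OF pq(3)] by blast
      obtain h' t' where ht': "E y' = h' # t'" "length t' = k - 1" using E_Cons[OF pq(4)] by blast
      have E_less: "(E y, E y') \<in> lexn r k \<longleftrightarrow> (h, h') \<in> r \<or> h = h' \<and> (t, t') \<in> lexn r (k - 1)"
        using Cons_in_lexn_Suc_iff[OF ht(2) ht'(2), of h h' r] ht(1) ht'(1)
        unfolding k_Suc[symmetric] by simp
      have "(t @ [v], t' @ [v']) \<in> lexn r ((k - 1) + Suc 0) \<longleftrightarrow>
          (t, t') \<in> lexn r (k - 1) \<or> t = t' \<and> ([v], [v']) \<in> lexn r (Suc 0)"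
        by (rule append_in_lexn_iff) (simp_all add: ht ht')
      then have E2_less: "(t @ [v], t' @ [v']) \<in> lexn r k \<longleftrightarrow>
          (t, t') \<in> lexn r (k - 1) \<or> t = t' \<and> (v, v') \<in> r"
        using k by (simp add: singleton_in_lexn_iff del: lexn.simps(2))
      have "y = y' \<longleftrightarrow> G y = G y' \<and> h = h' \<and> t = t'"
        using mk_F[OF pq(3)] mk_F[OF pq(4)] F_eq[OF pq(3)] F_eq[OF pq(4)] ht ht'
        by (metis list.inject)
      then show ?thesis
        using less_iff[OF pq(3,4)] E_less E2_less ht ht' pq(1,2) by (auto simp: G2_def E2_def)
    qed
    show "(z, o') \<in> M \<times> X" using zM o by blast
    show "G2 (z, o') = (z, o')" by (simp add: G2_def Gz E)
    show "\<exists>n. (G2 ^^ n) p = (z, o')" if pM: "p \<in> M \<times> X" for p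
    proof -
      have "fst ((G2 ^^ n) p) = (G ^^ n) (fst p)" for n by (induction n) (simp_all add: G2_def)
      moreover obtain n where "(G ^^ n) (fst p) = z" using ev[of "fst p"] pM by auto
      ultimately have "fst ((G2 ^^ n) p) = z" by simp
      \<comment> \<open>One further step corrects the second entry: once the first is
        \<open>z\<close>, \<open>G2\<close> replaces the second by
        \<open>hd (E z) = o'\<close>.\<close>
      then have "(G2 ^^ Suc n) p = (z, o')" by (simp add: G2_def Gz E)
      then show ?thesis by blast
    qed
  qed
  show ?thesis
    using order_isomorphic_trans[OF iso1 order_isomorphic_sym[OF iso2[unfolded E2z]]]
    unfolding M_def .
qed

section \<open>Assembling the cases\<close>

text \<open>The isomorphisms of the classes are glued, a pair being labelled by the class of its
  first coordinate. Differently labelled pairs differ in that coordinate, which then decides their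
  order.\<close>

lemma square_iso_no_max:
  assumes no_max: "\<And>x. x \<in> X \<Longrightarrow> \<exists>y\<in>X. (x, y) \<in> r"
  shows "order_isomorphic X r (X \<times> X) (r <*lex*> r)"
proof (rule order_isomorphic_glue[where c = orbit_class and c' = "\<lambda>p. orbit_class (fst p)"])
  show "orbit_class ` X = (\<lambda>p. orbit_class (fst p)) ` (X \<times> X)" by force
next
  fix M assume "M \<in> orbit_class ` X"
  then obtain x where x: "x \<in> X" "M = orbit_class x" by blast
  have mem: "orbit_class y = M \<longleftrightarrow> y \<in> M" if "y \<in> X" for y
    using orbit_class_eq[OF x(1)] orbit_class_self[OF that] x by blast
  have MX: "M \<subseteq> X" using orbit_class_subset x by blast
  have "{y\<in>X. orbit_class y = M} = M" using mem MX by blast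
  moreover have "{p\<in>X \<times> X. orbit_class (fst p) = M} = M \<times> X" using mem MX by force
  moreover have "order_isomorphic M r (M \<times> X) (r <*lex*> r)"
  proof (cases "\<exists>z\<in>M. \<forall>y\<in>M. (y, z) \<notin> r")
    case True
    then show ?thesis using orbit_class_iso_min[OF x(1)] x(2) by blast
  next
    case False
    then show ?thesis
      using orbit_class_iso_unbounded[OF x(1)] orbit_class_no_max[OF no_max x(1)] x(2) by blast
  qed
  ultimately show "order_isomorphic {y\<in>X. orbit_class y = M} r
      {p\<in>X \<times> X. orbit_class (fst p) = M} (r <*lex*> r)" by simp
next
  fix x x' p p'
  assume *: "x \<in> X" "x' \<in> X" "p \<in> X \<times> X" "p' \<in> X \<times> X" "orbit_class x = orbit_class (fst p)"
    "orbit_class x' = orbit_class (fst p')" "orbit_class x \<noteq> orbit_class x'"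
  then have "fst p \<in> orbit_class x" "fst p' \<in> orbit_class x'" using orbit_class_self by auto
  then have "(x, x') \<in> r \<longleftrightarrow> (fst p, fst p') \<in> r" using orbit_class_less * by blast
  moreover have "fst p \<noteq> fst p'" using * by auto
  ultimately show "(x, x') \<in> r \<longleftrightarrow> (p, p') \<in> r <*lex*> r" by (cases p; cases p') auto
qed

text \<open>As \<open>l\<close> is least, the pairs starting with \<open>l\<close> form an initial
  segment of the square. As \<open>h\<close> is greatest, the words starting with
  \<open>k - 1\<close> letters \<open>h\<close> form a final segment of the power.\<close>

lemma square_iso_min_max:
  assumes l: "l \<in> X" "\<And>x. x \<in> X \<Longrightarrow> (x, l) \<notin> r" and h: "h \<in> X" "\<And>x. x \<in> X \<Longrightarrow> (h, x) \<notin> r"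
  shows "order_isomorphic X r (X \<times> X) (r <*lex*> r)"
proof -
  define hs where "hs = replicate (k - 1) h"
  have len_hs: "length hs = k - 1" by (simp add: hs_def)
  define g where "g = (\<lambda>(a, b). mk (hs @ [a, b]))"
  have tup: "hs @ [a, b] \<in> tuples X (Suc k)" if "a \<in> X" "b \<in> X" for a b
    using that h k by (auto simp: hs_def tuples_def)
  have gX: "g (a, b) \<in> X" and Fg: "F (g (a, b)) = hs @ [a, b]" if "a \<in> X" "b \<in> X" for a b
    using mk_in[OF tup[OF that]] F_mk[OF tup[OF that]] by (simp_all add: g_def)
  have irr_hs: "(hs, hs) \<notin> lexn r (k - 1)" using irrefl_lexn[OF irr] by (simp add: irrefl_def)
  show ?thesis
  proof (rule Lindenbaum[where f = "\<lambda>v. (l, v)" and g = g])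
    show "irrefl r" "trans r" "total_on X r" by (fact irr, fact trans, fact total)
    show "irrefl (r <*lex*> r)" "trans (r <*lex*> r)" by (fact irrefl_lex, fact trans_lex)
    show "total_on (X \<times> X) (r <*lex*> r)" by (rule total_on_lex) simp
    show "(\<lambda>v. (l, v)) ` X \<subseteq> X \<times> X" using l by blast
    show "(u, v) \<in> r \<longleftrightarrow> ((l, u), (l, v)) \<in> r <*lex*> r" for u v using less_irrefl by simp
    show "p \<in> (\<lambda>v. (l, v)) ` X" if "p \<in> X \<times> X" "(p, (l, v)) \<in> r <*lex*> r" for v p
      using that l by auto
    show "g ` (X \<times> X) \<subseteq> X" using gX by auto
    show "(p, q) \<in> r <*lex*> r \<longleftrightarrow> (g p, g q) \<in> r" if "p \<in> X \<times> X" "q \<in> X \<times> X" for p q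
    proof -
      obtain a b a' b' where pq: "p = (a, b)" "q = (a', b')" by fastforce
      have X: "a \<in> X" "b \<in> X" "a' \<in> X" "b' \<in> X" using that pq by auto
      have "(g (a, b), g (a', b')) \<in> r \<longleftrightarrow>
          (hs, hs) \<in> lexn r (length hs) \<or> hs = hs \<and> ([a, b], [a', b']) \<in> lexn r (length [a, b])"
        by (rule less_iff_append) (simp_all add: gX Fg X)
      then show ?thesis
        using irr_hs len_hs pq by (simp add: Cons_in_lexn_Suc_iff singleton_in_lexn_iff del: lexn.simps(2))
    qed
    show "w \<in> g ` (X \<times> X)" if p: "p \<in> X \<times> X" and wX: "w \<in> X" and pw: "(g p, w) \<in> r" for p w
    proof -
      obtain a b where pq: "p = (a, b)" by fastforce
      have ab: "a \<in> X" "b \<in> X" using p pq by auto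
      define us where "us = take (k - 1) (F w)"
      have lenF: "length (F w) = Suc k" using F_tuple[OF wX] by (simp add: tuples_def)
      then have len_us: "length us = k - 1" by (simp add: us_def)
      have "length (drop (k - 1) (F w)) = Suc (Suc 0)" using lenF k by simp
      then obtain a' b' where d: "drop (k - 1) (F w) = [a', b']"
        by (metis length_0_conv length_Suc_conv)
      then have Fw: "F w = us @ [a', b']" unfolding us_def by (metis append_take_drop_id)
      have X: "a' \<in> X" "b' \<in> X" "set us \<subseteq> X" using F_tuple[OF wX] Fw by (auto simp: tuples_def)
      have "(hs, us) \<notin> lexn r (k - 1)"
      proof
        assume "(hs, us) \<in> lexn r (k - 1)"
        then obtain vs c d cs ds where *: "hs = vs @ c # cs" "us = vs @ d # ds" "(c, d) \<in> r"
          unfolding lexn_conv by blast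
        have "c \<in> set hs" using *(1) by simp
        then have "c = h" by (simp add: hs_def split: if_splits)
        moreover have "d \<in> X" using X(3) *(2) by auto
        ultimately show False using *(3) h by blast
      qed
      then have "us = hs"
        using less_iff_append[OF gX[OF ab] wX Fg[OF ab] Fw] pw pq len_hs len_us by auto
      then have "w = g (a', b')" using mk_F[OF wX] Fw by (simp add: g_def)
      then show ?thesis using X by blast
    qed
  qed
qed

end

lemma power_iso_imp_square_iso:
  assumes r: "strict_linear_order_on X r" and n: "1 < n"
    and iso: "order_isomorphic (tuples X n) (lexn r n) X r"
  shows "order_isomorphic (tuples X 2) (lexn r 2) X r"
\<comment> \<open>Exponent 2 is the conclusion itself; every other exponent is \<open>k + 1\<close>
  with \<open>k\<close> at least 2, as the locale requires.\<close>
proof (cases "n = 2")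
  case True
  then show ?thesis using iso by simp
next
  case False
  define k where "k = n - 1"
  have k: "2 \<le> k" "n = Suc k" using n False by (auto simp: k_def)
  obtain F where bij: "bij_betw F X (tuples X (Suc k))"
    and F: "\<And>x y. x \<in> X \<Longrightarrow> y \<in> X \<Longrightarrow> (x, y) \<in> r \<longleftrightarrow> (F x, F y) \<in> lexn r (Suc k)"
    using order_isomorphic_sym[OF iso] k(2) unfolding order_isomorphic_def by blast
  have slo: "irrefl r" "trans r" "total_on X r" using r by (auto simp: strict_linear_order_on_def)
  interpret power_fixed X r k F
    by unfold_locales (fact slo k(1) bij F)+
  have "order_isomorphic X r (X \<times> X) (r <*lex*> r)"
  proof (cases "\<exists>h\<in>X. \<forall>x\<in>X. (h, x) \<notin> r")
    case False
    then show ?thesis using square_iso_no_max by blast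
  next
    case max: True
    show ?thesis
    proof (cases "\<exists>l\<in>X. \<forall>x\<in>X. (x, l) \<notin> r")
      case True
      then show ?thesis using max square_iso_min_max by blast
    next
      case False
      \<comment> \<open>With a maximum but no minimum, reversing the order gives the case without
        maximum. The same \<open>F\<close> serves, because reversing \<open>r\<close> reverses the
        lexicographic order on words of equal length.\<close>
      interpret dual: power_fixed X "r\<inverse>" k F
      proof
        show "irrefl (r\<inverse>)" "trans (r\<inverse>)" "total_on X (r\<inverse>)"
          using slo by (auto simp: irrefl_def total_on_def)
        show "(x, y) \<in> r\<inverse> \<longleftrightarrow> (F x, F y) \<in> lexn (r\<inverse>) (Suc k)" if "x \<in> X" "y \<in> X" for x y
        proof -
          have "length (F x) = Suc k" "length (F y) = Suc k"
            using bij_betwE[OF bij] that by (auto simp: tuples_def)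
          then have "(F x, F y) \<in> lexn (r\<inverse>) (Suc k) \<longleftrightarrow> (F y, F x) \<in> lexn r (Suc k)"
            by (rule lexn_converse)
          then show ?thesis using F that by blast
        qed
      qed (use k bij in auto)
      have "order_isomorphic X (r\<inverse>) (X \<times> X) (r\<inverse> <*lex*> r\<inverse>)"
        by (rule dual.square_iso_no_max) (use False in blast)
      then have "order_isomorphic X ((r\<inverse>)\<inverse>) (X \<times> X) ((r\<inverse> <*lex*> r\<inverse>)\<inverse>)"
        by (rule order_isomorphic_converse)
      then show ?thesis by (rule order_isomorphic_cong) auto
    qed
  qed
  then have "order_isomorphic (X \<times> X) (r <*lex*> r) X r" by (rule order_isomorphic_sym)
  then show ?thesis
    by (rule order_isomorphic_trans[OF order_isomorphic_sym[OF order_isomorphic_power_2]])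
qed

theorem theorem4p14:
  fixes X :: "'a set" and r :: "'a rel"
  assumes "strict_linear_order_on X r"
  shows "((\<exists>n>1. order_isomorphic (tuples X n) (lexn r n) X r) \<longrightarrow>
            order_isomorphic (tuples X 2) (lexn r 2) X r) \<and>
         (order_isomorphic (tuples X 3) (lexn r 3) X r \<longrightarrow>
            order_isomorphic (tuples X 2) (lexn r 2) X r)"
proof (intro conjI impI)
  assume "\<exists>n>1. order_isomorphic (tuples X n) (lexn r n) X r"
  then show "order_isomorphic (tuples X 2) (lexn r 2) X r"
    using power_iso_imp_square_iso[OF assms] by blast
next
  assume "order_isomorphic (tuples X 3) (lexn r 3) X r"
  then show "order_isomorphic (tuples X 2) (lexn r 2) X r"
    by (rule power_iso_imp_square_iso[OF assms, rotated]) simp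
qed

end
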